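(* Let $(P,\le)$ be a homogeneous weakly ordered set. Suppose there exists an automorphism $\varphi:P\to P$ which generates $\le$ such that (1) $\varphi(x)>x$ for any $x\in P$; (2) $X_\varphi$ is simply connected; (3) $[x,\varphi(x)]$ is a lattice for any $x\in P$. Then $\le$ generates a partial order $\le_t$ on $P$, and $(P_{\ge_t x},\le_t)$ and $(P_{\le_t x},\le_t)$ are lattices for any $x\in P$.
   Context: A weakly ordered set is a set $P$ with a reflexive and antisymmetric binary relation $\le$ (not necessarily transitive) satisfying the following condition. Call $(a,b,c)\in P^3$ a transitive triple if $a\le b$, $b\le c$ and $a\le c$. For all $a,b,c,d\in P$ with $a\le b$, $b\le c$, $c\le d$: $(b,c,d)$ and $(a,b,d)$ are transitive triples if and only if $(a,b,c)$ and $(a,c,d)$ are transitive triples. Write $a<b$ for $a\le b$, $a\ne b$. The interval $[a,b]$ (for $a\le b$) is $\{z\in P: a\le z,\ z\le b\}$. For $x\in P$, $P_{\ge x}=\{z: z\ge x\}$ and $P_{\le x}=\{z: z\le x\}$; with the restriction of $\le$ these (and hence intervals) are posets. $P$ is homogeneous if there is a function $\ell$ from comparable pairs $a\le b$ to the non-negative integers such that $\ell(a\le c)=\ell(a\le b)+\ell(b\le c)$ for every transitive triple $(a,b,c)$, and $\ell(a\le b)=0$ if and only if $a=b$. A lattice is a poset in which any two elements have a join and a meet. A weak chain is a sequence $c_1<c_2<\dots<c_n$ in which consecutive elements are related as indicated. If $P$ contains no non-trivial weak chain starting and ending at the same element, then $\le$ generates a partial order $\le_t$: $a\le_t b$ if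 and only if $a$ and $b$ are the first and last elements of a weak chain. The assertion that $\le$ generates a partial order means that there are no such non-trivial closed weak chains. $P_{\ge_t x}$ and $P_{\le_t x}$ are the sets of elements $\ge_t x$, resp. $\le_t x$. An automorphism of $(P,\le)$ is a bijection of $P$ preserving the relation $\le$. Given an automorphism $\varphi$ with $\varphi(x)>x$ for all $x$, let $\le_\varphi$ be the subrelation of $\le$ consisting of all $a\le b$ such that $a,b\in[x,\varphi(x)]$ for some $x\in P$. We say $\varphi$ generates $\le$ if whenever $a\le b$, $a$ and $b$ are the first and last elements of a weak chain with respect to $\le_\varphi$. $X_\varphi$ is the simplicial complex with vertex set $P$, two distinct vertices $a,b$ being joined by an edge if $a\le_\varphi b$ (or $b\le_\varphi a$), whose simplices are the weak chains of $P$ contained in an interval of the form $[x,\varphi(x)]$, $x\in P$. *)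

theory Defs
  imports "HOL-Algebra.Lattice" "HOL-Analysis.Analysis"
begin

section \<open>Weakly ordered sets\<close>

definition transitive_triple :: "('a \<Rightarrow> 'a \<Rightarrow> bool) \<Rightarrow> 'a \<Rightarrow> 'a \<Rightarrow> 'a \<Rightarrow> bool" where
  "transitive_triple leq a b c \<longleftrightarrow> leq a b \<and> leq b c \<and> leq a c"

text \<open>The values of \<open>leq\<close> outside the carrier \<open>P\<close> are irrelevant.\<close>

definition weakly_ordered_set :: "'a set \<Rightarrow> ('a \<Rightarrow> 'a \<Rightarrow> bool) \<Rightarrow> bool" where
  "weakly_ordered_set P leq \<longleftrightarrow>
     (\<forall>a\<in>P. leq a a) \<and>
     (\<forall>a\<in>P. \<forall>b\<in>P. leq a b \<and> leq b a \<longrightarrow> a = b) \<and>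
     (\<forall>a\<in>P. \<forall>b\<in>P. \<forall>c\<in>P. \<forall>d\<in>P. leq a b \<and> leq b c \<and> leq c d \<longrightarrow>
        (transitive_triple leq b c d \<and> transitive_triple leq a b d \<longleftrightarrow>
         transitive_triple leq a b c \<and> transitive_triple leq a c d))"

definition homogeneous :: "'a set \<Rightarrow> ('a \<Rightarrow> 'a \<Rightarrow> bool) \<Rightarrow> bool" where
  "homogeneous P leq \<longleftrightarrow>
     (\<exists>l :: 'a \<Rightarrow> 'a \<Rightarrow> nat.
        (\<forall>a\<in>P. \<forall>b\<in>P. \<forall>c\<in>P. transitive_triple leq a b c \<longrightarrow> l a c = l a b + l b c) \<and>
        (\<forall>a\<in>P. \<forall>b\<in>P. leq a b \<longrightarrow> (l a b = 0 \<longleftrightarrow> a = b)))"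

definition interval :: "'a set \<Rightarrow> ('a \<Rightarrow> 'a \<Rightarrow> bool) \<Rightarrow> 'a \<Rightarrow> 'a \<Rightarrow> 'a set" where
  "interval P leq a b = {z \<in> P. leq a z \<and> leq z b}"

abbreviation lattice_on :: "'a set \<Rightarrow> ('a \<Rightarrow> 'a \<Rightarrow> bool) \<Rightarrow> bool" where
  "lattice_on A leq \<equiv> Lattice.lattice \<lparr>carrier = A, eq = (=), le = leq\<rparr>"

definition weak_chain :: "'a set \<Rightarrow> ('a \<Rightarrow> 'a \<Rightarrow> bool) \<Rightarrow> 'a list \<Rightarrow> bool" where
  "weak_chain P leq cs \<longleftrightarrow>
     cs \<noteq> [] \<and> set cs \<subseteq> P \<and> successively (\<lambda>a b. leq a b \<and> a \<noteq> b) cs"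

definition le_t :: "'a set \<Rightarrow> ('a \<Rightarrow> 'a \<Rightarrow> bool) \<Rightarrow> 'a \<Rightarrow> 'a \<Rightarrow> bool" where
  "le_t P leq a b \<longleftrightarrow> (\<exists>cs. weak_chain P leq cs \<and> hd cs = a \<and> last cs = b)"

definition generates_partial_order :: "'a set \<Rightarrow> ('a \<Rightarrow> 'a \<Rightarrow> bool) \<Rightarrow> bool" where
  "generates_partial_order P leq \<longleftrightarrow>
     \<not> (\<exists>cs. weak_chain P leq cs \<and> length cs \<ge> 2 \<and> hd cs = last cs)"

section \<open>Automorphisms and the complex they determine\<close>

definition order_automorphism :: "'a set \<Rightarrow> ('a \<Rightarrow> 'a \<Rightarrow> bool) \<Rightarrow> ('a \<Rightarrow> 'a) \<Rightarrow> bool" where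
  "order_automorphism P leq \<phi> \<longleftrightarrow>
     bij_betw \<phi> P P \<and> (\<forall>a\<in>P. \<forall>b\<in>P. leq (\<phi> a) (\<phi> b) \<longleftrightarrow> leq a b)"

definition le_phi :: "'a set \<Rightarrow> ('a \<Rightarrow> 'a \<Rightarrow> bool) \<Rightarrow> ('a \<Rightarrow> 'a) \<Rightarrow> 'a \<Rightarrow> 'a \<Rightarrow> bool" where
  "le_phi P leq \<phi> a b \<longleftrightarrow>
     leq a b \<and> (\<exists>x\<in>P. a \<in> interval P leq x (\<phi> x) \<and> b \<in> interval P leq x (\<phi> x))"

definition generates_relation :: "'a set \<Rightarrow> ('a \<Rightarrow> 'a \<Rightarrow> bool) \<Rightarrow> ('a \<Rightarrow> 'a) \<Rightarrow> bool" where
  "generates_relation P leq \<phi> \<longleftrightarrow>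
     (\<forall>a\<in>P. \<forall>b\<in>P. leq a b \<longrightarrow>
        (\<exists>cs. weak_chain P (le_phi P leq \<phi>) cs \<and> hd cs = a \<and> last cs = b))"

text \<open>An abstract simplicial complex is given by the set of its (nonempty, finite) simplices; the
  edges of the following complex are exactly the pairs of distinct \<open>le_phi\<close>-comparable
  elements.\<close>

definition X_phi :: "'a set \<Rightarrow> ('a \<Rightarrow> 'a \<Rightarrow> bool) \<Rightarrow> ('a \<Rightarrow> 'a) \<Rightarrow> 'a set set" where
  "X_phi P leq \<phi> =
     {set cs | cs. weak_chain P leq cs \<and> (\<exists>x\<in>P. set cs \<subseteq> interval P leq x (\<phi> x))}"

section \<open>Geometric realization and simple connectedness\<close>

text \<open>Points are given by barycentric coordinates. Each closed simplex carries its Euclidean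
  topology (for finite \<open>\<sigma>\<close> the topology of pointwise convergence), and the realization carries
  the weak (coherent) topology, in which a set is open iff its trace on every closed simplex is.\<close>

definition closed_simplex :: "'a set \<Rightarrow> ('a \<Rightarrow> real) set" where
  "closed_simplex \<sigma> = {t. (\<forall>v. 0 \<le> t v) \<and> (\<forall>v. v \<notin> \<sigma> \<longrightarrow> t v = 0) \<and> sum t \<sigma> = 1}"

definition realization :: "'a set set \<Rightarrow> ('a \<Rightarrow> real) topology" where
  "realization K =
     topology (\<lambda>U. U \<subseteq> (\<Union>\<sigma>\<in>K. closed_simplex \<sigma>) \<and>
       (\<forall>\<sigma>\<in>K. openin (top_of_set (closed_simplex \<sigma>)) (U \<inter> closed_simplex \<sigma>)))"

lemma openin_realization:
  "openin (realization K) U \<longleftrightarrow>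
     U \<subseteq> (\<Union>\<sigma>\<in>K. closed_simplex \<sigma>) \<and>
     (\<forall>\<sigma>\<in>K. openin (top_of_set (closed_simplex \<sigma>)) (U \<inter> closed_simplex \<sigma>))"
proof -
  have "istopology (\<lambda>U. U \<subseteq> (\<Union>\<sigma>\<in>K. closed_simplex \<sigma>) \<and>
       (\<forall>\<sigma>\<in>K. openin (top_of_set (closed_simplex \<sigma>)) (U \<inter> closed_simplex \<sigma>)))"
    unfolding istopology_def
  proof (intro conjI allI impI ballI)
    fix S T \<sigma>
    assume S: "S \<subseteq> (\<Union>\<sigma>\<in>K. closed_simplex \<sigma>) \<and>
        (\<forall>\<sigma>\<in>K. openin (top_of_set (closed_simplex \<sigma>)) (S \<inter> closed_simplex \<sigma>))"
      and T: "T \<subseteq> (\<Union>\<sigma>\<in>K. closed_simplex \<sigma>) \<and>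
        (\<forall>\<sigma>\<in>K. openin (top_of_set (closed_simplex \<sigma>)) (T \<inter> closed_simplex \<sigma>))"
    show "S \<inter> T \<subseteq> (\<Union>\<sigma>\<in>K. closed_simplex \<sigma>)" using S by blast
    assume "\<sigma> \<in> K"
    then have "openin (top_of_set (closed_simplex \<sigma>))
        ((S \<inter> closed_simplex \<sigma>) \<inter> (T \<inter> closed_simplex \<sigma>))"
      using S T by (metis openin_Int)
    moreover have "(S \<inter> closed_simplex \<sigma>) \<inter> (T \<inter> closed_simplex \<sigma>) = S \<inter> T \<inter> closed_simplex \<sigma>"
      by blast
    ultimately show "openin (top_of_set (closed_simplex \<sigma>)) (S \<inter> T \<inter> closed_simplex \<sigma>)"
      by (simp only:)
  next
    fix \<U> \<sigma>
    assume U: "\<forall>S\<in>\<U>. S \<subseteq> (\<Union>\<sigma>\<in>K. closed_simplex \<sigma>) \<and>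
        (\<forall>\<sigma>\<in>K. openin (top_of_set (closed_simplex \<sigma>)) (S \<inter> closed_simplex \<sigma>))"
    show "\<Union>\<U> \<subseteq> (\<Union>\<sigma>\<in>K. closed_simplex \<sigma>)" using U by blast
    assume \<sigma>: "\<sigma> \<in> K"
    have "openin (top_of_set (closed_simplex \<sigma>)) (\<Union>S\<in>\<U>. S \<inter> closed_simplex \<sigma>)"
      by (rule openin_Union) (use U \<sigma> in blast)
    then show "openin (top_of_set (closed_simplex \<sigma>)) (\<Union>\<U> \<inter> closed_simplex \<sigma>)"
      by (simp only: Int_Union2)
  qed
  then show ?thesis
    unfolding realization_def by (subst topology_inverse') (assumption, rule refl)
qed

lemma topspace_realization: "topspace (realization K) = (\<Union>\<sigma>\<in>K. closed_simplex \<sigma>)"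
proof
  show "topspace (realization K) \<subseteq> (\<Union>\<sigma>\<in>K. closed_simplex \<sigma>)"
    using openin_realization[of K "topspace (realization K)"] openin_topspace by blast
  have "(\<Union>\<sigma>\<in>K. closed_simplex \<sigma>) \<inter> closed_simplex \<tau> = closed_simplex \<tau>" if "\<tau> \<in> K" for \<tau>
    using that by blast
  then have "openin (realization K) (\<Union>\<sigma>\<in>K. closed_simplex \<sigma>)"
    unfolding openin_realization by (metis openin_subtopology_self subset_refl)
  then show "(\<Union>\<sigma>\<in>K. closed_simplex \<sigma>) \<subseteq> topspace (realization K)"
    by (rule openin_subset)
qed

text \<open>Path-connected with every loop null-homotopic relative to its base point.\<close>

definition simply_connected_space :: "'b topology \<Rightarrow> bool" where
  "simply_connected_space X \<longleftrightarrow>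
     path_connected_space X \<and>
     (\<forall>p. pathin X p \<and> p 0 = p 1 \<longrightarrow>
        homotopic_with (\<lambda>r. r 0 = p 0 \<and> r 1 = p 0) (top_of_set {0..1}) X p (\<lambda>_. p 0))"

end

theory Submission
  imports Defs
begin

text \<open>Write \<open>a \<sqsubseteq> b\<close> for \<open>le_phi\<close>, that is, \<open>a \<le> b \<le> \<phi> a\<close>. Strict \<open>\<sqsubseteq>\<close>-chains, modulo replacing
  \<open>a, b, c\<close> by \<open>a, c\<close> whenever \<open>a \<sqsubseteq> c\<close>, are the morphisms of a Garside category whose simple morphisms
  out of \<open>a\<close> are the elements of \<open>[a, \<phi> a]\<close>. As in Garside's treatment of the braid monoid, an
  induction on the length shows that this category is left cancellative and that two chains from
  \<open>a\<close> through \<open>b\<close> and through \<open>c\<close> that are equivalent both factor through the join of \<open>b\<close> and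
  \<open>c\<close>. Since \<open>b \<sqsubseteq> a\<close> implies \<open>a \<sqsubseteq> \<phi> b\<close>, every edge path of \<open>X\<^sub>\<phi>\<close> lifts to a chain, and homotopic edge
  paths have equivalent lifts after composing with sufficiently many steps \<open>x \<sqsubseteq> \<phi> x\<close>, which can be
  cancelled. Simple connectedness therefore makes any two chains with the same ends equivalent.
  Hence there is no closed chain, the length is a grading, and the local joins extend step by step
  to joins in \<open>P\<^bsub>\<ge>x\<^esub>\<close>; meets are joins of all lower bounds, and \<open>P\<^bsub>\<le>x\<^esub>\<close> is treated by passing to the
  opposite order with \<open>\<phi>\<close> replaced by its inverse.\<close>

section \<open>Edge paths in a simply connected complex\<close>

text \<open>Simplices are sets, so \<open>triangle\<close> covers the case \<open>c = a\<close> and,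
  followed by \<open>degenerate\<close> when \<open>{a}\<close> is in \<open>K\<close>, removes a
  backtrack \<open>a, b, a\<close>. The free tail \<open>w\<close> in the last two rules yields
  closure under appending on the right.\<close>

inductive edge_homotopic :: "'a set set \<Rightarrow> 'a list \<Rightarrow> 'a list \<Rightarrow> bool" for K where
  refl: "edge_homotopic K w w"
| sym: "edge_homotopic K w w' \<Longrightarrow> edge_homotopic K w' w"
| trans: "edge_homotopic K w w' \<Longrightarrow> edge_homotopic K w' w'' \<Longrightarrow> edge_homotopic K w w''"
| cons: "edge_homotopic K w w' \<Longrightarrow> edge_homotopic K (a # w) (a # w')"
| triangle: "{a, b, c} \<in> K \<Longrightarrow> edge_homotopic K (a # b # c # w) (a # c # w)"
| degenerate: "{a} \<in> K \<Longrightarrow> edge_homotopic K (a # a # w) (a # w)"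

declare edge_homotopic.trans [trans]

definition edge_path :: "'a set set \<Rightarrow> 'a list \<Rightarrow> bool" where
  "edge_path K w \<longleftrightarrow> w \<noteq> [] \<and> successively (\<lambda>a b. {a, b} \<in> K) w"

lemma edge_homotopic_append_left:
  "edge_homotopic K w w' \<Longrightarrow> edge_homotopic K (u @ w) (u @ w')"
  by (induction u) (auto intro: edge_homotopic.cons)

lemma edge_homotopic_append_right:
  "edge_homotopic K w w' \<Longrightarrow> edge_homotopic K (w @ v) (w' @ v)"
  by (induction rule: edge_homotopic.induct) (auto intro: edge_homotopic.intros)

lemma edge_homotopic_triangle_mid:
  "{a, b, c} \<in> K \<Longrightarrow> edge_homotopic K (u @ [a, b, c]) (u @ [a, c])"
  by (intro edge_homotopic_append_left edge_homotopic.triangle)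

section \<open>Stars, simplices and continuity in the weak topology\<close>

locale face_closed =
  fixes K :: "'a set set"
  assumes face: "\<sigma> \<in> K \<Longrightarrow> \<tau> \<subseteq> \<sigma> \<Longrightarrow> \<tau> \<noteq> {} \<Longrightarrow> \<tau> \<in> K"
begin

text \<open>The open star of the vertex \<open>v\<close>, cut out of each closed simplex by one
  coordinate inequality. The stars of all vertices form the cover to which the Lebesgue number is
  applied.\<close>

lemma openin_star: "openin (realization K) {t \<in> topspace (realization K). 0 < t v}"
  unfolding openin_realization
proof (intro conjI ballI)
  show "{t \<in> topspace (realization K). 0 < t v} \<subseteq> (\<Union>\<sigma>\<in>K. closed_simplex \<sigma>)"
    by (auto simp: topspace_realization)
  fix \<sigma> assume \<sigma>: "\<sigma> \<in> K"
  have "{t \<in> topspace (realization K). 0 < t v} \<inter> closed_simplex \<sigma>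
      = closed_simplex \<sigma> \<inter> {t. 0 < t v}"
    using \<sigma> by (auto simp: topspace_realization)
  moreover have "open {t :: 'a \<Rightarrow> real. 0 < t v}"
    by (intro open_Collect_less continuous_on_const continuous_on_product_coordinates)
  ultimately show "openin (top_of_set (closed_simplex \<sigma>))
      ({t \<in> topspace (realization K). 0 < t v} \<inter> closed_simplex \<sigma>)"
    by (metis openin_open)
qed

lemma closed_closed_simplex: "closed (closed_simplex (\<sigma> :: 'a set))"
proof -
  \<comment> \<open>An infinite \<open>\<sigma>\<close> is harmless: the sum is then 0 by
    convention, so the set is empty and in particular closed.\<close>
  have eq: "closed_simplex \<sigma> = (\<Inter>v. {t. 0 \<le> t v}) \<inter> (\<Inter>v\<in>-\<sigma>. {t. t v = 0}) \<inter> {t. sum t \<sigma> = 1}"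
    by (auto simp: closed_simplex_def)
  show ?thesis unfolding eq
    by (intro closed_Int closed_INT ballI closed_Collect_le closed_Collect_eq
        continuous_on_const continuous_on_product_coordinates continuous_on_sum)
qed

text \<open>The weak topology may be finer than that of pointwise convergence. As the image lies in
  finitely many closed simplices, the preimage of a closed set is the preimage of a finite union of
  pointwise closed sets.\<close>

lemma continuous_map_into_realization:
  assumes cont: "\<And>v. continuous_on S (\<lambda>x. f x v)" and fin: "finite F" and FK: "F \<subseteq> K"
    and im: "\<And>x. x \<in> S \<Longrightarrow> \<exists>\<sigma>\<in>F. f x \<in> closed_simplex \<sigma>"
  shows "continuous_map (top_of_set S) (realization K) f"
proof -
  have contf: "continuous_on S f"
    using cont by (rule continuous_on_coordinatewise_then_product)
  have "closedin (top_of_set S) {x \<in> S. f x \<in> C}" if C: "closedin (realization K) C" for C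
  proof -
    have "closedin (realization K) C \<Longrightarrow> closed (C \<inter> closed_simplex \<sigma>)" if "\<sigma> \<in> F" for \<sigma>
    proof -
      have s: "\<sigma> \<in> K" using that FK by auto
      have "openin (realization K) (topspace (realization K) - C)" using C by auto
      then have "openin (top_of_set (closed_simplex \<sigma>))
          ((topspace (realization K) - C) \<inter> closed_simplex \<sigma>)"
        using s by (simp add: openin_realization)
      moreover have "(topspace (realization K) - C) \<inter> closed_simplex \<sigma> =
          topspace (top_of_set (closed_simplex \<sigma>)) - (C \<inter> closed_simplex \<sigma>)"
        using s by (auto simp: topspace_realization)
      ultimately have "closedin (top_of_set (closed_simplex \<sigma>)) (C \<inter> closed_simplex \<sigma>)"
        unfolding closedin_def by simp
      then show ?thesis
        using closed_closed_simplex closedin_closed_trans by blast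
    qed
    then have "closed (\<Union>\<sigma>\<in>F. C \<inter> closed_simplex \<sigma>)"
      using fin C by (intro closed_UN) auto
    then have "closedin (top_of_set S) (S \<inter> f -` (\<Union>\<sigma>\<in>F. C \<inter> closed_simplex \<sigma>))"
      using contf continuous_closedin_preimage by blast
    moreover have "S \<inter> f -` (\<Union>\<sigma>\<in>F. C \<inter> closed_simplex \<sigma>) = {x \<in> S. f x \<in> C}"
      using im by auto
    ultimately show ?thesis by simp
  qed
  moreover have "f \<in> S \<rightarrow> topspace (realization K)"
    using im FK by (force simp: topspace_realization)
  ultimately show ?thesis
    unfolding continuous_map_closedin by auto
qed

text \<open>The point lies in some closed simplex, which must contain \<open>\<sigma>\<close> as a
  face. Hence vertices whose open stars have a common point span a simplex.\<close>

lemma common_star_simplex: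
  assumes "q \<in> topspace (realization K)" and "\<sigma> \<noteq> {}" and "\<And>v. v \<in> \<sigma> \<Longrightarrow> 0 < q v"
  shows "\<sigma> \<in> K"
proof -
  obtain \<tau> where \<tau>: "\<tau> \<in> K" "q \<in> closed_simplex \<tau>"
    using assms(1) by (auto simp: topspace_realization)
  have "\<sigma> \<subseteq> \<tau>"
    using assms(3) \<tau>(2) by (fastforce simp: closed_simplex_def)
  then show ?thesis using face \<tau>(1) assms(2) by blast
qed

end

text \<open>The piecewise linear path along the vertices \<open>w\<close>, with \<open>w ! k\<close> reached at time \<open>k / n\<close>
  where \<open>n = length w - 1\<close>.\<close>

definition pl_path :: "'a list \<Rightarrow> real \<Rightarrow> 'a \<Rightarrow> real" where
  "pl_path w t v = (\<Sum>k<length w. max 0 (1 - \<bar>real (length w - 1) * t - real k\<bar>) * of_bool (w ! k = v))"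

text \<open>The summands are hat functions supported within distance 1 of \<open>k\<close>, so on
  the segment starting at \<open>i\<close> only those at \<open>i\<close> and \<open>Suc i\<close>
  survive; they interpolate linearly.\<close>

lemma pl_path_segment:
  assumes "Suc i < length w" and "real i \<le> real (length w - 1) * t"
    and "real (length w - 1) * t \<le> real (Suc i)"
  shows "pl_path w t v = (1 - (real (length w - 1) * t - real i)) * of_bool (w ! i = v)
    + (real (length w - 1) * t - real i) * of_bool (w ! Suc i = v)"
proof -
  define n where "n = real (length w - 1)"
  have "pl_path w t v = (\<Sum>k\<in>{i, Suc i}. max 0 (1 - \<bar>n * t - real k\<bar>) * of_bool (w ! k = v))"
    unfolding pl_path_def n_def[symmetric]
  proof (rule sum.mono_neutral_right)
    show "\<forall>k\<in>{..<length w} - {i, Suc i}. max 0 (1 - \<bar>n * t - real k\<bar>) * of_bool (w ! k = v) = 0"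
    proof
      fix k assume "k \<in> {..<length w} - {i, Suc i}"
      then have "k < i \<or> Suc i < k" by auto
      then have "real k + 1 \<le> real i \<or> real i + 2 \<le> real k" by linarith
      then have "1 \<le> \<bar>n * t - real k\<bar>" using assms n_def by auto
      then show "max 0 (1 - \<bar>n * t - real k\<bar>) * of_bool (w ! k = v) = 0" by simp
    qed
  qed (use assms in auto)
  also have "\<dots> = (1 - (n * t - real i)) * of_bool (w ! i = v)
    + (n * t - real i) * of_bool (w ! Suc i = v)"
    using assms by (simp add: n_def max_def)
  finally show ?thesis by (simp add: n_def)
qed

lemma pl_path_in_simplex:
  assumes "Suc i < length w" and "real i \<le> real (length w - 1) * t"
    and "real (length w - 1) * t \<le> real (Suc i)"
  shows "pl_path w t \<in> closed_simplex {w ! i, w ! Suc i}"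
  using assms pl_path_segment[OF assms]
  by (cases "w ! i = w ! Suc i") (auto simp: closed_simplex_def)

lemma pl_path_vertex:
  assumes "1 < length w" and "k < length w"
  shows "pl_path w (real k / real (length w - 1)) = (\<lambda>v. of_bool (w ! k = v))"
proof
  fix v
  show "pl_path w (real k / real (length w - 1)) v = of_bool (w ! k = v)"
  proof (cases "Suc k < length w")
    case True
    then show ?thesis using assms by (subst pl_path_segment[of k]) auto
  next
    case False
    \<comment> \<open>The last vertex begins no segment; it is reached as the end of the preceding
      one.\<close>
    then obtain i where k: "k = Suc i" "Suc i < length w"
      using assms by (cases k) auto
    show ?thesis unfolding k(1) using assms k by (subst pl_path_segment[of i]) auto
  qed
qed

lemma segment_index:
  assumes "0 \<le> x" and "x \<le> real n" and "0 < n"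
  obtains i where "i < n" "real i \<le> x" "x \<le> real (Suc i)"
proof (cases "x = real n")
  case True
  \<comment> \<open>At the right end the floor would be \<open>n\<close>, one index too
    large.\<close>
  then show ?thesis using that[of "n - 1"] assms by auto
next
  case False
  then show ?thesis using that[of "nat \<lfloor>x\<rfloor>"] assms by (simp; linarith)
qed

context face_closed
begin

lemma pathin_pl_path:
  assumes w: "edge_path K w" and len: "1 < length w"
  shows "pathin (realization K) (pl_path w)"
  unfolding pathin_def
proof (rule continuous_map_into_realization)
  show "continuous_on {0..1} (\<lambda>x. pl_path w x v)" for v
    unfolding pl_path_def by (intro continuous_intros)
  let ?F = "(\<lambda>i. {w ! i, w ! Suc i}) ` {..<length w - 1}"
  show "finite ?F" by simp
  show "?F \<subseteq> K"
    using w by (auto simp: edge_path_def successively_conv_nth)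
  fix x :: real assume "x \<in> {0..1}"
  then obtain i where "i < length w - 1" "real i \<le> real (length w - 1) * x"
      "real (length w - 1) * x \<le> real (Suc i)"
    using segment_index[of "real (length w - 1) * x" "length w - 1"] len
    by (force simp: mult_left_le)
  then show "\<exists>\<sigma>\<in>?F. pl_path w x \<in> closed_simplex \<sigma>"
    by (intro bexI[of _ "{w ! i, w ! Suc i}"] pl_path_in_simplex) auto
qed

end

section \<open>From a null-homotopy to an edge homotopy by subdividing the square\<close>

text \<open>The Lebesgue number lemma on the compact unit square. The claim covers every
  \<open>N\<close> from \<open>M\<close> on, since the grid used later must also be a multiple of
  the number of edges.\<close>

lemma square_grid_Lebesgue:
  fixes h :: "real \<times> real \<Rightarrow> 'b"
  assumes h: "continuous_map (prod_topology (top_of_set {0..1}) (top_of_set {0..1})) X h"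
    and op: "\<And>v. openin X (U v)" and cover: "topspace X \<subseteq> (\<Union>v. U v)"
  obtains M :: nat where "0 < M"
    and "\<And>N i j. M \<le> N \<Longrightarrow> i < N \<Longrightarrow> j < N \<Longrightarrow>
      \<exists>v. \<forall>s\<in>{real i / real N..real (Suc i) / real N}. \<forall>t\<in>{real j / real N..real (Suc j) / real N}. h (s, t) \<in> U v"
proof -
  let ?Q = "{0..1::real} \<times> {0..1::real}"
  have h': "continuous_map (top_of_set ?Q) X h"
    using h by (simp only: prod_topology_subtopology_eu)
  have "\<exists>B. open B \<and> {z \<in> ?Q. h z \<in> U v} = ?Q \<inter> B" for v
    using openin_continuous_map_preimage[OF h' op[of v]] by (auto simp: openin_open)
  then obtain B where B: "\<And>v. open (B v)" "\<And>v. {z \<in> ?Q. h z \<in> U v} = ?Q \<inter> B v"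
    by metis
  have "?Q \<subseteq> \<Union>(range B)"
  proof
    fix z assume z: "z \<in> ?Q"
    then have "h z \<in> topspace X" using h' by (auto simp: continuous_map_def)
    then obtain v where "h z \<in> U v" using cover by auto
    then show "z \<in> \<Union>(range B)" using z B(2)[of v] by auto
  qed
  then obtain \<delta> where \<delta>: "0 < \<delta>" "\<And>T. T \<subseteq> ?Q \<Longrightarrow> diameter T < \<delta> \<Longrightarrow> \<exists>B\<in>range B. T \<subseteq> B"
    using B(1) by (rule_tac Lebesgue_number_lemma[of ?Q "range B"]) (auto simp: compact_Times)
  obtain M :: nat where M: "2 / \<delta> < real M" using reals_Archimedean2 by blast
  show ?thesis
  proof
    have "0 < 2 / \<delta>" using \<delta>(1) by simp
    then show M0: "0 < M" using M by (metis less_trans of_nat_0_less_iff)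
    fix N i j assume N: "M \<le> N" "i < N" "j < N"
    let ?T = "{real i / real N..real (Suc i) / real N} \<times> {real j / real N..real (Suc j) / real N}"
    have N0: "0 < real N" using N M0 by simp
    have "2 / \<delta> < real N" using M N by linarith
    then have small: "2 / real N < \<delta>" using N0 \<delta>(1) by (simp add: field_simps)
    have TQ: "?T \<subseteq> ?Q"
    proof -
      have "real i / real N \<ge> 0" "real j / real N \<ge> 0" "real (Suc i) / real N \<le> 1" "real (Suc j) / real N \<le> 1"
        using N N0 by auto
      then show ?thesis unfolding times_subset_iff atLeastatMost_subset_iff by blast
    qed
    have "diameter ?T \<le> 2 / real N"
    proof (rule diameter_le)
      show "?T \<noteq> {} \<or> 0 \<le> 2 / real N" using N0 by simp
      fix x y assume xy: "x \<in> ?T" "y \<in> ?T"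
      have "dist x y \<le> dist (fst x) (fst y) + dist (snd x) (snd y)"
        by (metis dist_Pair_Pair prod.collapse sqrt_sum_squares_le_sum zero_le_dist)
      also have "\<dots> \<le> 1 / real N + 1 / real N"
        using xy by (intro add_mono) (auto simp: dist_real_def abs_le_iff add_divide_distrib)
      finally show "norm (x - y) \<le> 2 / real N" by (simp add: dist_norm)
    qed
    then obtain v where "?T \<subseteq> B v" using \<delta>(2)[OF TQ] small by auto
    then have "\<forall>z\<in>?T. h z \<in> U v" using B(2)[of v] TQ by blast
    then show "\<exists>v. \<forall>s\<in>{real i / real N..real (Suc i) / real N}.
        \<forall>t\<in>{real j / real N..real (Suc j) / real N}. h (s, t) \<in> U v"
      by blast
  qed
qed

context face_closed
begin

text \<open>A null-homotopy of the piecewise linear loop is cut into cells so small that each maps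
  into the open star of a vertex, its label. Labels of cells with a common corner span a simplex, so
  neighbouring rows of labels are edge homotopic; the first row deforms to \<open>w\<close> and the
  last is constant.\<close>

theorem simply_connected_imp_edge_homotopic:
  assumes sc: "simply_connected_space (realization K)"
    and w: "edge_path K w" and closed: "hd w = last w"
  shows "edge_homotopic K w [hd w]"
proof (cases "length w \<le> 1")
  case True
  then have "w = [hd w]" using w by (cases w) (auto simp: edge_path_def)
  then show ?thesis by (metis edge_homotopic.refl)
next
  case False
  define n where "n = length w - 1"
  define z where "z = hd w"
  have n: "0 < n" "length w = Suc n" using False by (auto simp: n_def)
  have w0: "w ! 0 = z" using n by (simp add: z_def hd_conv_nth flip: length_greater_0_conv)
  have wn: "w ! n = z" using n closed last_conv_nth[of w] by (force simp: z_def)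
  have vertex: "pl_path w (real k / real n) = (\<lambda>v. of_bool (w ! k = v))" if "k \<le> n" for k
    using pl_path_vertex[of w k] that n by simp
  define e where "e = (\<lambda>v. of_bool (z = v) :: real)"
  have p0: "pl_path w 0 = e" using vertex[of 0] w0 by (simp add: e_def)
  have p1: "pl_path w 1 = e" using vertex[of n] wn n by (simp add: e_def)
  have "homotopic_with (\<lambda>r. r 0 = e \<and> r 1 = e) (top_of_set {0..1}) (realization K)
      (pl_path w) (\<lambda>_. e)"
  proof -
    have "pathin (realization K) (pl_path w)" using pathin_pl_path[OF w] False by simp
    then show ?thesis
      using sc[unfolded simply_connected_space_def, THEN conjunct2, rule_format, of "pl_path w"] p0 p1
      by simp
  qed
  then have "\<exists>h. continuous_map (prod_topology (top_of_set {0..1::real}) (top_of_set {0..1})) (realization K) h \<and>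
      (\<forall>t. h (0, t) = pl_path w t) \<and> (\<forall>t. h (1, t) = e) \<and> (\<forall>s\<in>{0..1}. h (s, 0) = e \<and> h (s, 1) = e)"
    unfolding homotopic_with_def .
  then obtain h where H: "continuous_map (prod_topology (top_of_set {0..1::real}) (top_of_set {0..1})) (realization K) h \<and>
      (\<forall>t. h (0, t) = pl_path w t) \<and> (\<forall>t. h (1, t) = e) \<and> (\<forall>s\<in>{0..1}. h (s, 0) = e \<and> h (s, 1) = e)" ..
  from H have h: "continuous_map (prod_topology (top_of_set {0..1::real}) (top_of_set {0..1})) (realization K) h" ..
  have h0: "h (0, t) = pl_path w t" and h1: "h (1, t) = e" for t
    using H by simp_all
  have hl: "h (s, 0) = e" and hr: "h (s, 1) = e" if "s \<in> {0..1}" for s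
    using H that by simp_all
  have cover: "topspace (realization K) \<subseteq> (\<Union>v. {t \<in> topspace (realization K). 0 < t v})"
  proof
    fix t assume t: "t \<in> topspace (realization K)"
    then obtain \<sigma> where "t \<in> closed_simplex \<sigma>" by (auto simp: topspace_realization)
    then have "sum t \<sigma> \<noteq> 0" "\<forall>v. 0 \<le> t v"
      by (simp_all add: closed_simplex_def)
    then have "\<exists>v. t v \<noteq> 0" "\<forall>v. 0 \<le> t v"
      by (metis sum.neutral, simp)
    then show "t \<in> (\<Union>v. {t \<in> topspace (realization K). 0 < t v})"
      using t by (auto simp: order_less_le)
  qed
  obtain M where M: "0 < M" "\<And>N i j. M \<le> N \<Longrightarrow> i < N \<Longrightarrow> j < N \<Longrightarrow>
      \<exists>v. \<forall>s\<in>{real i / real N..real (Suc i) / real N}. \<forall>t\<in>{real j / real N..real (Suc j) / real N}.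
        h (s, t) \<in> {t \<in> topspace (realization K). 0 < t v}"
    by (rule square_grid_Lebesgue[OF h openin_star cover]) (rule that)
  \<comment> \<open>A multiple of \<open>n\<close> that is at least \<open>M\<close>: the cells are
    small enough, and the times \<open>k / n\<close> of the vertices of \<open>w\<close> are the
    grid points \<open>x (k * M)\<close>.\<close>
  define N where "N = n * M"
  have N: "M \<le> N" "0 < N" using n M(1) by (auto simp: N_def)
  define x where "x i = real i / real N" for i
  have xmono: "x i \<le> x k" if "i \<le> k" for i k
    using that by (simp add: x_def divide_right_mono)
  have x01: "x i \<in> {0..1}" if "i \<le> N" for i
    using that N(2) by (simp add: x_def)
  have x0: "x 0 = 0" and xN: "x N = 1" using N(2) by (simp_all add: x_def)
  have "\<exists>v. \<forall>s\<in>{x i..x (Suc i)}. \<forall>t\<in>{x j..x (Suc j)}. h (s, t) \<in> topspace (realization K) \<and> 0 < h (s, t) v"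
    if "i < N" "j < N" for i j
    using M(2)[OF N(1) that] unfolding x_def by simp
  then obtain v where v: "\<And>i j s t. i < N \<Longrightarrow> j < N \<Longrightarrow> s \<in> {x i..x (Suc i)} \<Longrightarrow> t \<in> {x j..x (Suc j)} \<Longrightarrow>
       h (s, t) \<in> topspace (realization K) \<and> 0 < h (s, t) (v i j)"
    by metis
  have xs: "x k \<in> {x i..x (Suc i)}" if "k = i \<or> k = Suc i" for i k
    using that xmono[of i "Suc i"] by auto
  \<comment> \<open>The three cells share the grid point \<open>(x k, x l)\<close>, whose image has
    positive coordinates at all three labels.\<close>
  have simplex: "{v i j, v i' j', v i'' j''} \<in> K"
    if "i < N" "j < N" "i' < N" "j' < N" "i'' < N" "j'' < N"
      "k = i \<or> k = Suc i" "k = i' \<or> k = Suc i'" "k = i'' \<or> k = Suc i''"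
      "l = j \<or> l = Suc j" "l = j' \<or> l = Suc j'" "l = j'' \<or> l = Suc j''" for i j i' j' i'' j'' k l
    using v[OF that(1,2) xs xs, of k l] v[OF that(3,4) xs xs, of k l] v[OF that(5,6) xs xs, of k l] that
    by (intro common_star_simplex[of "h (x k, x l)"]) auto
  \<comment> \<open>On the sides and at the end of the homotopy the map takes the value
    \<open>e\<close>, whose only positive coordinate is at \<open>z\<close>; a cell touching there
    must be labelled \<open>z\<close>.\<close>
  have left: "v i 0 = z" if "i < N" for i
    using v[OF that N(2) xs xs, of i 0] hl[of "x i"] x01[of i] x0 that
    by (auto simp: e_def split: if_splits)
  have right: "v i (N - 1) = z" if "i < N" for i
    using v[OF that _ xs xs, of "N - 1" i N] hr[of "x i"] x01[of i] xN that N(2)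
    by (auto simp: e_def split: if_splits)
  have top: "v (N - 1) j = z" if "j < N" for j
    using v[OF _ that xs xs, of "N - 1" N j] h1[of "x j"] xN N(2)
    by (auto simp: e_def split: if_splits)
  have zK: "{z} \<in> K"
    using simplex[of 0 0 0 0 0 0 0 0] N(2) left[of 0] by simp
  \<comment> \<open>The sweep between two rows treats one square of four labels at a time. The
    diagonal from \<open>v i j\<close> to \<open>v (Suc i) (Suc j)\<close> cuts it into two
    triangles, by which the path along one side is exchanged for the path along the other.\<close>
  have ladder: "edge_homotopic K (map (v i) [0..<Suc j] @ [v (Suc i) j]) (map (v (Suc i)) [0..<Suc j])"
    if i: "Suc i < N" and "j < N" for i j
    using \<open>j < N\<close>
  proof (induction j)
    case 0
    then show ?case using left i zK by (auto intro: edge_homotopic.degenerate)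
  next
    case (Suc j)
    let ?u = "map (v i) [0..<j]"
    have "edge_homotopic K (?u @ [v i j, v i (Suc j), v (Suc i) (Suc j)]) (?u @ [v i j, v (Suc i) (Suc j)])"
      using simplex[of i j i "Suc j" "Suc i" "Suc j" "Suc i" "Suc j"] i Suc.prems
      by (intro edge_homotopic_triangle_mid) simp
    also have "edge_homotopic K (?u @ [v i j, v (Suc i) (Suc j)])
        (?u @ [v i j, v (Suc i) j, v (Suc i) (Suc j)])"
      using simplex[of i j "Suc i" j "Suc i" "Suc j" "Suc i" "Suc j"] i Suc.prems
      by (intro edge_homotopic.sym[OF edge_homotopic_triangle_mid]) simp
    also have "edge_homotopic K \<dots> (map (v (Suc i)) [0..<Suc j] @ [v (Suc i) (Suc j)])"
      using edge_homotopic_append_right[OF Suc.IH, of "[v (Suc i) (Suc j)]"] Suc.prems by simp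
    finally show ?case by simp
  qed
  define row where "row i = map (v i) [0..<N]" for i
  have row_eq: "row i = map (v i) [0..<N - 1] @ [z]" if "i < N" for i
    using right[OF that] N(2) by (cases N) (simp_all add: row_def)
  have step: "edge_homotopic K (row i) (row (Suc i))" if "Suc i < N" for i
  proof -
    have "edge_homotopic K (row i @ [z]) (row i)"
      using row_eq[of i] that zK
      by (auto intro!: edge_homotopic_append_left edge_homotopic.degenerate)
    moreover have "edge_homotopic K (row i @ [z]) (row (Suc i))"
      using ladder[OF that, of "N - 1"] right[OF that] N(2) by (simp add: row_def)
    ultimately show ?thesis by (rule edge_homotopic.trans[OF edge_homotopic.sym])
  qed
  have rows: "edge_homotopic K (row 0) (row i)" if "i < N" for i
    using that
  proof (induction i)
    case (Suc i)
    then show ?case using step[of i] by (auto intro: edge_homotopic.trans)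
  qed (rule edge_homotopic.refl)
  have const: "edge_homotopic K (replicate (Suc k) z) [z]" for k
  proof (induction k)
    case (Suc k)
    have "edge_homotopic K (replicate (Suc (Suc k)) z) (replicate (Suc k) z)"
      using zK by (simp add: edge_homotopic.degenerate)
    then show ?case using Suc.IH by (rule edge_homotopic.trans)
  qed (simp add: edge_homotopic.refl)
  have "row (N - 1) = replicate (Suc (N - 1)) z"
    using top N(2) by (intro nth_equalityI) (auto simp: row_def nth_replicate simp del: replicate_Suc)
  then have row_const: "edge_homotopic K (row 0) [z]"
    using rows[of "N - 1"] const[of "N - 1"] N(2) by (auto intro: edge_homotopic.trans)
  have nx: "real n * x j = real j / real M" for j
    using n M(1) by (simp add: x_def N_def)
  \<comment> \<open>At the left end \<open>x j\<close> of the cell the path lies on the edge from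
    \<open>w ! k\<close> to \<open>w ! Suc k\<close>, and a positive coordinate there belongs to an
    end point of the edge.\<close>
  have bottom: "v 0 j \<in> {w ! k, w ! Suc k}" if "j < N" "k * M \<le> j" "j \<le> Suc k * M" "k < n" for j k
  proof -
    have "real k \<le> real n * x j" "real n * x j \<le> real (Suc k)"
      using that(2,3) M(1) unfolding nx
      by (simp_all add: le_divide_eq divide_le_eq flip: of_nat_mult of_nat_Suc)
    then have "pl_path w (x j) \<in> closed_simplex {w ! k, w ! Suc k}"
      using pl_path_in_simplex[of k w "x j"] that(4) n by simp
    then show ?thesis
      using v[OF N(2) that(1) xs xs, of 0 j] h0[of "x j"] x0 by (fastforce simp: closed_simplex_def)
  qed
  \<comment> \<open>If the time of \<open>w ! k\<close> is the left or right end of the cell, the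
    path is at that vertex itself, which determines the label.\<close>
  have corner: "v 0 j = w ! k" if "j < N" "k * M = j \<or> k * M = Suc j" "k \<le> n" for j k
  proof -
    have "x (k * M) = real k / real n" using M(1) by (simp add: x_def N_def)
    then have "pl_path w (x (k * M)) = (\<lambda>v. of_bool (w ! k = v))" using vertex that(3) by simp
    then show ?thesis
      using v[OF N(2) that(1) xs xs, of 0 "k * M"] h0[of "x (k * M)"] x0 that(2)
      by (auto split: if_splits)
  qed
  have edge: "{w ! k, w ! Suc k} \<in> K" if "k < n" for k
    using w that n by (auto simp: edge_path_def successively_conv_nth)
  \<comment> \<open>The labels up to cell \<open>j\<close> contract to the vertices of
    \<open>w\<close> already passed, followed by the current label. Inside an edge a triangle
    removes the old label; when a vertex of \<open>w\<close> is reached, \<open>corner\<close>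
    identifies the old label with it.\<close>
  have main: "edge_homotopic K (map (v 0) [0..<Suc j]) (take (Suc (j div M)) w @ [v 0 j])" if "j < N" for j
    using that
  proof (induction j)
    case 0
    have "take (Suc 0) w = [z]" using w0 n by (cases w) auto
    then show ?case
      using left[OF N(2)] zK by (auto intro: edge_homotopic.sym edge_homotopic.degenerate)
  next
    case (Suc j)
    define k where "k = j div M"
    have k: "k < n" "k * M \<le> j" "j < Suc k * M"
      using Suc.prems M(1) dividend_less_div_times[of M j]
      by (simp_all add: k_def N_def less_mult_imp_div_less)
    have "edge_homotopic K (map (v 0) [0..<Suc (Suc j)]) (take (Suc k) w @ [v 0 j, v 0 (Suc j)])"
      using edge_homotopic_append_right[OF Suc.IH, of "[v 0 (Suc j)]"] Suc.prems by (simp add: k_def)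
    also have "edge_homotopic K \<dots> (take (Suc (Suc j div M)) w @ [v 0 (Suc j)])"
    proof (cases "Suc j = Suc k * M")
      case True
      then have "v 0 j = w ! Suc k" "Suc j div M = Suc k"
        using corner[of j "Suc k"] k(1) Suc.prems M(1) by auto
      moreover have "take (Suc (Suc k)) w = take (Suc k) w @ [w ! Suc k]"
        using k(1) n by (simp add: take_Suc_conv_app_nth)
      ultimately show ?thesis by (simp add: edge_homotopic.refl)
    next
      case False
      then have "Suc j < Suc k * M" using k(3) by simp
      then have "Suc j div M = k" using k(2) by (intro div_nat_eqI) (auto simp: mult.commute)
      moreover have "take (Suc k) w = take k w @ [w ! k]"
        using k(1) n by (simp add: take_Suc_conv_app_nth)
      moreover have "{w ! k, v 0 j, v 0 (Suc j)} \<in> K"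
        using face[OF edge[OF k(1)]] bottom[of j k] bottom[of "Suc j" k] k Suc.prems \<open>Suc j < Suc k * M\<close>
        by auto
      ultimately show ?thesis using edge_homotopic_triangle_mid[of "w ! k"] by simp
    qed
    finally show ?case .
  qed
  \<comment> \<open>The last cell lies on the last edge, and its label \<open>z\<close> is the last
    vertex of \<open>w\<close>.\<close>
  have "(N - 1) div M = n - 1"
    using n M(1) by (intro div_nat_eqI) (auto simp: N_def algebra_simps)
  then have "edge_homotopic K (row 0) (take n w @ [z])"
    using main[of "N - 1"] right[OF N(2)] N(2) n by (simp add: row_def)
  moreover have "take n w @ [z] = w"
    using wn n by (metis lessI order_refl take_Suc_conv_app_nth take_all)
  ultimately show ?thesis
    using edge_homotopic.trans[OF edge_homotopic.sym row_const] by (simp add: z_def)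
qed

end

section \<open>The category of chains\<close>

text \<open>\<open>phi_top\<close> says that everything above \<open>a\<close> is below
  \<open>\<phi> a\<close>, \<open>le_assoc\<close> is the associativity that survives the lack of
  transitivity, and simple connectedness enters only through the combinatorial
  \<open>loop_trivial\<close>. Isolating these axioms permits a second interpretation with the order
  reversed.\<close>

locale garside_germ =
  fixes P :: "'a set" and le :: "'a \<Rightarrow> 'a \<Rightarrow> bool" (infix "\<sqsubseteq>" 50)
    and \<phi> :: "'a \<Rightarrow> 'a" and l :: "'a \<Rightarrow> 'a \<Rightarrow> nat" and K :: "'a set set"
  assumes le_carrier: "a \<sqsubseteq> b \<Longrightarrow> a \<in> P \<and> b \<in> P"
    and le_refl: "a \<in> P \<Longrightarrow> a \<sqsubseteq> a"
    and le_antisym: "a \<sqsubseteq> b \<Longrightarrow> b \<sqsubseteq> a \<Longrightarrow> a = b"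
    and le_assoc: "a \<sqsubseteq> b \<Longrightarrow> b \<sqsubseteq> c \<Longrightarrow> c \<sqsubseteq> d \<Longrightarrow> a \<sqsubseteq> d \<Longrightarrow> a \<sqsubseteq> c \<longleftrightarrow> b \<sqsubseteq> d"
    and phi_bij: "bij_betw \<phi> P P"
    and phi_le_iff: "a \<in> P \<Longrightarrow> b \<in> P \<Longrightarrow> \<phi> a \<sqsubseteq> \<phi> b \<longleftrightarrow> a \<sqsubseteq> b"
    and le_phi: "a \<in> P \<Longrightarrow> a \<sqsubseteq> \<phi> a"
    and phi_neq: "a \<in> P \<Longrightarrow> \<phi> a \<noteq> a"
    and phi_top: "a \<sqsubseteq> b \<Longrightarrow> b \<sqsubseteq> \<phi> a"
    and ex_join: "a \<sqsubseteq> b \<Longrightarrow> a \<sqsubseteq> c \<Longrightarrow>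
      \<exists>j. a \<sqsubseteq> j \<and> b \<sqsubseteq> j \<and> c \<sqsubseteq> j \<and> (\<forall>m. a \<sqsubseteq> m \<and> b \<sqsubseteq> m \<and> c \<sqsubseteq> m \<longrightarrow> j \<sqsubseteq> m)"
    and l_add: "a \<sqsubseteq> b \<Longrightarrow> b \<sqsubseteq> c \<Longrightarrow> a \<sqsubseteq> c \<Longrightarrow> l a c = l a b + l b c"
    and l_eq_0: "a \<sqsubseteq> b \<Longrightarrow> l a b = 0 \<longleftrightarrow> a = b"
    and simplex_chain: "\<sigma> \<in> K \<Longrightarrow> \<exists>x. \<forall>a\<in>\<sigma>. x \<sqsubseteq> a \<and> (\<forall>b\<in>\<sigma>. a \<sqsubseteq> b \<or> b \<sqsubseteq> a)"
    and edge_simplex: "a \<sqsubseteq> b \<Longrightarrow> {a, b} \<in> K"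
    and loop_trivial: "edge_path K w \<Longrightarrow> hd w = last w \<Longrightarrow> edge_homotopic K w [hd w]"
begin

abbreviation chain :: "'a list \<Rightarrow> bool" where
  "chain \<equiv> weak_chain P le"

lemma chain_singleton [simp]: "chain [a] \<longleftrightarrow> a \<in> P"
  by (auto simp: weak_chain_def)

lemma chain_Cons_Cons [simp]: "chain (a # b # p) \<longleftrightarrow> a \<sqsubseteq> b \<and> a \<noteq> b \<and> chain (b # p)"
  using le_carrier by (auto simp: weak_chain_def)

lemma chain_Nil [simp]: "\<not> chain []"
  by (simp add: weak_chain_def)

lemma chain_Cons: "chain (a # p) \<longleftrightarrow> (if p = [] then a \<in> P else a \<sqsubseteq> hd p \<and> a \<noteq> hd p \<and> chain p)"
  by (cases p) auto

lemma chain_neq_Nil: "chain p \<Longrightarrow> p \<noteq> []"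
  by auto

lemma chain_in_carrier: "chain p \<Longrightarrow> a \<in> set p \<Longrightarrow> a \<in> P"
  by (auto simp: weak_chain_def)

lemma chain_hd: "chain p \<Longrightarrow> hd p \<in> P"
  by (auto simp: weak_chain_def)

lemma chain_last: "chain p \<Longrightarrow> last p \<in> P"
  by (auto simp: weak_chain_def)

lemma phi_carrier: "a \<in> P \<Longrightarrow> \<phi> a \<in> P"
  using phi_bij by (auto simp: bij_betw_def)

lemma phi_inj: "a \<in> P \<Longrightarrow> b \<in> P \<Longrightarrow> \<phi> a = \<phi> b \<longleftrightarrow> a = b"
  using phi_bij by (auto simp: bij_betw_def inj_on_def)

lemma phi_mono: "a \<sqsubseteq> b \<Longrightarrow> \<phi> a \<sqsubseteq> \<phi> b"
  using phi_le_iff le_carrier by blast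

section \<open>Equivalence of chains and composition with possibly trivial steps\<close>

fun chain_length :: "'a list \<Rightarrow> nat" where
  "chain_length (a # b # p) = l a b + chain_length (b # p)"
| "chain_length _ = 0"

text \<open>The relations of the category: two steps are merged when their composite is again a
  single step.\<close>

inductive chain_eq :: "'a list \<Rightarrow> 'a list \<Rightarrow> bool" (infix "\<simeq>" 50) where
  chain_eq_refl: "chain p \<Longrightarrow> p \<simeq> p"
| chain_eq_sym: "p \<simeq> q \<Longrightarrow> q \<simeq> p"
| chain_eq_trans: "p \<simeq> q \<Longrightarrow> q \<simeq> r \<Longrightarrow> p \<simeq> r"
| chain_eq_Cons: "p \<simeq> q \<Longrightarrow> chain (a # p) \<Longrightarrow> a # p \<simeq> a # q"
| chain_eq_skip: "chain (a # b # c # p) \<Longrightarrow> a \<sqsubseteq> c \<Longrightarrow> a # b # c # p \<simeq> a # c # p"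

declare chain_eq_trans [trans]

text \<open>Merging preserves the length by \<open>l_add\<close>. The result is again strict, since
  \<open>a = c\<close> would force \<open>a = b\<close> by antisymmetry, and it still has a step;
  this last invariant later excludes closed chains.\<close>

lemma chain_eq_invariants:
  "p \<simeq> q \<Longrightarrow> chain p \<and> chain q \<and> hd p = hd q \<and> last p = last q \<and>
     chain_length p = chain_length q \<and> (tl p = [] \<longleftrightarrow> tl q = [])"
proof (induction rule: chain_eq.induct)
  case (chain_eq_Cons p q a)
  then obtain x p' q' where "p = x # p'" "q = x # q'"
    by (metis chain_neq_Nil list.exhaust list.sel(1))
  then show ?case using chain_eq_Cons by auto
next
  case (chain_eq_skip a b c p)
  then show ?case using le_antisym[of a b] by (auto simp: l_add)
qed auto

lemma chain_eq_chain: "p \<simeq> q \<Longrightarrow> chain p" "p \<simeq> q \<Longrightarrow> chain q"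
  and chain_eq_hd: "p \<simeq> q \<Longrightarrow> hd p = hd q"
  and chain_eq_last: "p \<simeq> q \<Longrightarrow> last p = last q"
  and chain_eq_length: "p \<simeq> q \<Longrightarrow> chain_length p = chain_length q"
  and chain_eq_tl: "p \<simeq> q \<Longrightarrow> tl p = [] \<longleftrightarrow> tl q = []"
  using chain_eq_invariants by blast+

text \<open>Composition with a step that may be an identity. Chains are strict, so identities have
  to be omitted.\<close>

definition ext :: "'a \<Rightarrow> 'a list \<Rightarrow> 'a list" where
  "ext a p = (if hd p = a then p else a # p)"

lemma hd_ext [simp]: "hd (ext a p) = a"
  by (simp add: ext_def)

lemma ext_hd [simp]: "ext (hd p) p = p"
  by (simp add: ext_def)

lemma last_ext: "p \<noteq> [] \<Longrightarrow> last (ext a p) = last p"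
  by (simp add: ext_def)

lemma chain_ext: "chain p \<Longrightarrow> a \<sqsubseteq> hd p \<Longrightarrow> chain (ext a p)"
  by (auto simp: ext_def chain_Cons)

lemma ext_cong: "p \<simeq> q \<Longrightarrow> a \<sqsubseteq> hd p \<Longrightarrow> ext a p \<simeq> ext a q"
  using chain_eq_hd[of p q] chain_eq_chain[of p q]
  by (auto simp: ext_def chain_Cons intro!: chain_eq_Cons)

lemma ext_ext:
  assumes "chain p" "a \<sqsubseteq> b" "b \<sqsubseteq> hd p" "a \<sqsubseteq> hd p"
  shows "ext a (ext b p) \<simeq> ext a p"
proof (cases "a = b \<or> b = hd p")
  case True
  then have "ext a (ext b p) = ext a p" by (auto simp: ext_def)
  then show ?thesis using chain_ext[OF assms(1,4)] by (simp add: chain_eq_refl)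
next
  case False
  obtain c p' where p: "p = c # p'" using assms(1) by (cases p) auto
  have "a \<noteq> c" using False assms le_antisym[of a b] by (auto simp: p)
  then show ?thesis using False assms chain_eq_skip[of a b c p'] by (auto simp: ext_def p)
qed

section \<open>Local joins and Garside cancellation\<close>

text \<open>The base \<open>a\<close> matters: since \<sqsubseteq> is not transitive, only those
  upper bounds \<open>m\<close> with \<open>a \<sqsubseteq> m\<close> compete.\<close>

definition join :: "'a \<Rightarrow> 'a \<Rightarrow> 'a \<Rightarrow> 'a" where
  "join a b c = (THE j. a \<sqsubseteq> j \<and> b \<sqsubseteq> j \<and> c \<sqsubseteq> j \<and> (\<forall>m. a \<sqsubseteq> m \<and> b \<sqsubseteq> m \<and> c \<sqsubseteq> m \<longrightarrow> j \<sqsubseteq> m))"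

lemma join_eqI:
  assumes "a \<sqsubseteq> j" "b \<sqsubseteq> j" "c \<sqsubseteq> j" "\<And>m. a \<sqsubseteq> m \<Longrightarrow> b \<sqsubseteq> m \<Longrightarrow> c \<sqsubseteq> m \<Longrightarrow> j \<sqsubseteq> m"
  shows "join a b c = j"
  unfolding join_def using assms by (intro the_equality) (auto intro: le_antisym)

lemma join_props:
  assumes "a \<sqsubseteq> b" "a \<sqsubseteq> c"
  shows le_join: "a \<sqsubseteq> join a b c" and le_join1: "b \<sqsubseteq> join a b c" and le_join2: "c \<sqsubseteq> join a b c"
    and join_least: "\<And>m. a \<sqsubseteq> m \<Longrightarrow> b \<sqsubseteq> m \<Longrightarrow> c \<sqsubseteq> m \<Longrightarrow> join a b c \<sqsubseteq> m"
proof -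
  obtain j where j: "a \<sqsubseteq> j" "b \<sqsubseteq> j" "c \<sqsubseteq> j" "\<And>m. a \<sqsubseteq> m \<Longrightarrow> b \<sqsubseteq> m \<Longrightarrow> c \<sqsubseteq> m \<Longrightarrow> j \<sqsubseteq> m"
    using ex_join[OF assms] by blast
  then have "join a b c = j" by (rule join_eqI)
  then show "a \<sqsubseteq> join a b c" "b \<sqsubseteq> join a b c" "c \<sqsubseteq> join a b c"
      "\<And>m. a \<sqsubseteq> m \<Longrightarrow> b \<sqsubseteq> m \<Longrightarrow> c \<sqsubseteq> m \<Longrightarrow> join a b c \<sqsubseteq> m"
    using j by auto
qed

lemma join_absorb: "a \<sqsubseteq> b \<Longrightarrow> b \<sqsubseteq> c \<Longrightarrow> a \<sqsubseteq> c \<Longrightarrow> join a b c = c"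
  "a \<sqsubseteq> b \<Longrightarrow> b \<sqsubseteq> c \<Longrightarrow> a \<sqsubseteq> c \<Longrightarrow> join a c b = c"
  by (rule join_eqI; auto intro: le_refl dest: le_carrier)+

lemma join_idem: "a \<sqsubseteq> b \<Longrightarrow> join a b b = b"
  using join_absorb(1)[of a b b] le_refl le_carrier by blast

text \<open>For \<open>b = c\<close> this says that the first step of \<open>p\<close> and \<open>q\<close> can be cancelled.\<close>

definition cancellable :: "'a list \<Rightarrow> 'a list \<Rightarrow> bool" where
  "cancellable p q \<longleftrightarrow> (\<forall>a b c u v. p = a # b # u \<longrightarrow> q = a # c # v \<longrightarrow>
     (\<exists>r. chain r \<and> hd r = join a b c \<and> b # u \<simeq> ext b r \<and> c # v \<simeq> ext c r))"

text \<open>Extends \<open>cancellable\<close> to first steps that may be identities. If one of them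
  is trivial, the join is the head of the other chain, which itself serves as the remainder
  \<open>r\<close>.\<close>

lemma cancellable_ext:
  assumes can: "cancellable (ext c p) (ext c q)" and eq: "ext c p \<simeq> ext c q"
    and p: "chain p" "c \<sqsubseteq> hd p" and q: "chain q" "c \<sqsubseteq> hd q"
  shows "\<exists>r. chain r \<and> hd r = join c (hd p) (hd q) \<and> p \<simeq> ext (hd p) r \<and> q \<simeq> ext (hd q) r"
proof -
  have cc: "c \<sqsubseteq> c" using p(2) le_refl le_carrier by blast
  consider "hd p = c" | "hd q = c" | "hd p \<noteq> c" "hd q \<noteq> c" by blast
  then show ?thesis
  proof cases
    case 1
    then have "p \<simeq> ext (hd p) q" using eq by (metis ext_hd)
    moreover have "join c (hd p) (hd q) = hd q" using 1 q(2) cc join_absorb(1) by metis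
    ultimately show ?thesis using q chain_eq_refl by (intro exI[of _ q]) auto
  next
    case 2
    then have "q \<simeq> ext (hd q) p" using eq by (metis ext_hd chain_eq_sym)
    moreover have "join c (hd p) (hd q) = hd p" using 2 p(2) cc join_absorb(2) by metis
    ultimately show ?thesis using p chain_eq_refl by (intro exI[of _ p]) auto
  next
    case 3
    obtain b u d v where uv: "p = b # u" "q = d # v"
      using p(1) q(1) by (metis chain_neq_Nil list.exhaust)
    then have "ext c p = c # b # u" "ext c q = c # d # v" using 3 by (auto simp: ext_def)
    then show ?thesis using can unfolding cancellable_def uv by simp
  qed
qed

text \<open>Garside's argument: a rule induction at fixed length \<open>n\<close>, with shorter
  chains already settled. Only transitivity is hard. There the two remainders obtained from the
  middle chain are compared after removing its first step, which shortens the chain.\<close>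

lemma cancellable_step:
  assumes IH: "\<And>p q. p \<simeq> q \<Longrightarrow> chain_length p < n \<Longrightarrow> cancellable p q"
    and "p \<simeq> q" and "chain_length p = n"
  shows "cancellable p q"
  using assms(2,3)
proof (induction rule: chain_eq.induct)
  case (chain_eq_refl p)
  show ?case unfolding cancellable_def
  proof (intro allI impI)
    fix a b c u v assume "p = a # b # u" "p = a # c # v"
    then show "\<exists>r. chain r \<and> hd r = join a b c \<and> b # u \<simeq> ext b r \<and> c # v \<simeq> ext c r"
      using chain_eq_refl
      by (intro exI[of _ "b # u"]) (auto simp: join_idem ext_def intro: chain_eq.chain_eq_refl)
  qed
next
  case (chain_eq_sym p q)
  then have can: "cancellable p q" using chain_eq_length by metis
  show ?case unfolding cancellable_def
  proof (intro allI impI)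
    fix a b c u v assume "q = a # b # u" "p = a # c # v"
    then obtain r where "chain r" "hd r = join a c b" "c # v \<simeq> ext c r" "b # u \<simeq> ext b r"
      using can unfolding cancellable_def by blast
    moreover have "join a c b = join a b c" unfolding join_def by (rule arg_cong[of _ _ The]) blast
    ultimately show "\<exists>r. chain r \<and> hd r = join a b c \<and> b # u \<simeq> ext b r \<and> c # v \<simeq> ext c r" by auto
  qed
next
  case (chain_eq_trans p m q)
  have len: "chain_length m = n" using chain_eq_trans chain_eq_length by metis
  have can: "cancellable p m" "cancellable m q" using chain_eq_trans len by auto
  show ?case unfolding cancellable_def
  proof (intro allI impI)
    fix a b d u w assume p: "p = a # b # u" and q: "q = a # d # w"
    have "tl m \<noteq> []" "hd m = a" "m \<noteq> []"
      using chain_eq_tl[OF chain_eq_trans.hyps(1)] chain_eq_hd[OF chain_eq_trans.hyps(1)]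
        chain_eq_chain[OF chain_eq_trans.hyps(1)] p by auto
    then obtain c v where m: "m = a # c # v" by (metis list.exhaust list.sel(1,3))
    obtain r1 where r1: "chain r1" "hd r1 = join a b c" "b # u \<simeq> ext b r1" "c # v \<simeq> ext c r1"
      using can(1) p m unfolding cancellable_def by blast
    obtain r2 where r2: "chain r2" "hd r2 = join a c d" "c # v \<simeq> ext c r2" "d # w \<simeq> ext d r2"
      using can(2) q m unfolding cancellable_def by blast
    have ch: "chain p" "chain m" "chain q" using chain_eq_trans.hyps chain_eq_chain by blast+
    have ab: "a \<sqsubseteq> b" and ac: "a \<sqsubseteq> c" "a \<noteq> c" and ad: "a \<sqsubseteq> d" using ch p m q by auto
    have ca: "a \<in> P" using ab le_carrier by blast
    note j1 = join_props[OF ab ac(1)] and j2 = join_props[OF ac(1) ad] and j3 = join_props[OF ab ad]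
    \<comment> \<open>Both sides are equivalent to the tail of the middle chain, so the hypothesis
      on shorter chains provides a common continuation \<open>r\<close>.\<close>
    have eq: "ext c r1 \<simeq> ext c r2" using r1(4) r2(3) chain_eq.chain_eq_sym chain_eq.chain_eq_trans by blast
    have "chain_length (c # v) < n"
      using len m l_eq_0[OF ac(1)] ac(2) by simp
    then have "cancellable (ext c r1) (ext c r2)"
      using IH[OF eq] chain_eq_length[OF r1(4)] by simp
    then obtain r where r: "chain r" "hd r = join c (join a b c) (join a c d)"
        "r1 \<simeq> ext (join a b c) r" "r2 \<simeq> ext (join a c d) r"
      using cancellable_ext[OF _ eq r1(1) _ r2(1)] r1(2) r2(2) j1(3) j2(2) by auto
    define J where "J = hd r"
    note jj = join_props[OF j1(3) j2(2), folded r(2), folded J_def]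
    \<comment> \<open>\<open>\<phi> a\<close> bounds both local joins and hence \<open>J\<close>.
      Associativity along \<open>a, c, J, \<phi> a\<close> then gives
      \<open>a \<sqsubseteq> J\<close> without transitivity.\<close>
    have "J \<sqsubseteq> \<phi> a"
    proof (rule jj(4))
      show "c \<sqsubseteq> \<phi> a" "join a b c \<sqsubseteq> \<phi> a" "join a c d \<sqsubseteq> \<phi> a"
        using phi_top ac(1) j1(1) j2(1) by auto
    qed
    then have aJ: "a \<sqsubseteq> J"
      using le_assoc[OF ac(1) jj(1), of "\<phi> a"] phi_top[OF ac(1)] le_phi[OF ca] by blast
    have bJ: "b \<sqsubseteq> J" using le_assoc[OF ab j1(2) jj(2) aJ] j1(1) by blast
    have dJ: "d \<sqsubseteq> J" using le_assoc[OF ad j2(3) jj(3) aJ] j2(1) by blast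
    have bdJ: "join a b d \<sqsubseteq> J" using j3(4)[OF aJ bJ dJ] .
    \<comment> \<open>The required remainder starts at \<open>join a b d\<close>, which lies below
      the head \<open>J\<close> of \<open>r\<close>.\<close>
    let ?r = "ext (join a b d) r"
    have chr: "chain ?r" using chain_ext r(1) bdJ J_def by blast
    have "b # u \<simeq> ext b ?r"
    proof -
      note r1(3)
      also have "ext b r1 \<simeq> ext b (ext (join a b c) r)"
        using ext_cong[OF r(3)] r1(2) j1(2) by simp
      also have "\<dots> \<simeq> ext b r" using ext_ext[OF r(1) j1(2)] jj(2) bJ J_def by simp
      also have "\<dots> \<simeq> ext b ?r"
        using chain_eq.chain_eq_sym[OF ext_ext[OF r(1) j3(2)]] bdJ bJ J_def by simp
      finally show ?thesis .
    qed
    moreover have "d # w \<simeq> ext d ?r"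
    proof -
      note r2(4)
      also have "ext d r2 \<simeq> ext d (ext (join a c d) r)"
        using ext_cong[OF r(4)] r2(2) j2(3) by simp
      also have "\<dots> \<simeq> ext d r" using ext_ext[OF r(1) j2(3)] jj(3) dJ J_def by simp
      also have "\<dots> \<simeq> ext d ?r"
        using chain_eq.chain_eq_sym[OF ext_ext[OF r(1) j3(3)]] bdJ dJ J_def by simp
      finally show ?thesis .
    qed
    ultimately show "\<exists>r. chain r \<and> hd r = join a b d \<and> b # u \<simeq> ext b r \<and> d # w \<simeq> ext d r"
      using chr by (intro exI[of _ ?r]) simp
  qed
next
  case (chain_eq_Cons p q a)
  show ?case unfolding cancellable_def
  proof (intro allI impI)
    fix a' b c u v assume "a # p = a' # b # u" "a # q = a' # c # v"
    then have *: "a' = a" "p = b # u" "q = c # v" by auto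
    then have "c = b" using chain_eq_hd[OF chain_eq_Cons.hyps(1)] by simp
    then show "\<exists>r. chain r \<and> hd r = join a' b c \<and> b # u \<simeq> ext b r \<and> c # v \<simeq> ext c r"
      using chain_eq_Cons.hyps * chain_eq_chain[OF chain_eq_Cons.hyps(1)]
      by (intro exI[of _ "b # u"])
        (auto simp: join_idem ext_def intro: chain_eq.chain_eq_refl chain_eq.chain_eq_sym)
  qed
next
  case (chain_eq_skip a b c p)
  show ?case unfolding cancellable_def
  proof (intro allI impI)
    fix a' b' c' u v assume "a # b # c # p = a' # b' # u" "a # c # p = a' # c' # v"
    then have *: "a' = a" "b' = b" "c' = c" "u = c # p" "v = p" by auto
    show "\<exists>r. chain r \<and> hd r = join a' b' c' \<and> b' # u \<simeq> ext b' r \<and> c' # v \<simeq> ext c' r"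
      \<comment> \<open>Here \<open>b \<sqsubseteq> c\<close>, so the join is \<open>c\<close> and
        the common remainder is the tail starting there.\<close>
      using chain_eq_skip unfolding *
      by (intro exI[of _ "c # p"]) (auto simp: join_absorb(1) ext_def intro: chain_eq.chain_eq_refl)
  qed
qed

theorem chain_eq_cancellable: "p \<simeq> q \<Longrightarrow> cancellable p q"
proof (induction "chain_length p" arbitrary: p q rule: less_induct)
  case less
  show ?case
    using cancellable_step[of "chain_length p"] less by blast
qed

lemma chain_eq_ext_ext:
  assumes "ext c p \<simeq> ext c q" "chain p" "c \<sqsubseteq> hd p" "chain q" "c \<sqsubseteq> hd q"
  obtains r where "chain r" "hd r = join c (hd p) (hd q)" "p \<simeq> ext (hd p) r" "q \<simeq> ext (hd q) r"
  using cancellable_ext[OF chain_eq_cancellable[OF assms(1)] assms] by blast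

lemma left_cancel:
  assumes "a # p \<simeq> a # q" "chain p" "chain q" "hd p = hd q"
  shows "p \<simeq> q"
proof -
  have "a \<sqsubseteq> hd p" "a \<noteq> hd p"
    using chain_eq_chain(1)[OF assms(1)] assms(2) by (auto simp: chain_Cons split: if_splits)
  then obtain r where "hd r = join a (hd p) (hd p)" "p \<simeq> ext (hd p) r" "q \<simeq> ext (hd p) r"
    using chain_eq_ext_ext[of a p q] assms by (auto simp: ext_def)
  then show ?thesis using chain_eq_sym chain_eq_trans by blast
qed

section \<open>Action of the automorphism and stabilization\<close>

lemma chain_map:
  assumes "f ` P \<subseteq> P" "inj_on f P" "\<And>a b. a \<sqsubseteq> b \<Longrightarrow> f a \<sqsubseteq> f b" "chain p"
  shows "chain (map f p)"
  using assms(4)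
proof (induction p rule: induct_list012)
  case (3 a b p)
  then show ?case using assms(2,3) le_carrier by (auto simp: inj_on_def)
qed (use assms(1) in auto)

lemma chain_eq_map:
  assumes f: "f ` P \<subseteq> P" "inj_on f P" "\<And>a b. a \<sqsubseteq> b \<Longrightarrow> f a \<sqsubseteq> f b" and "p \<simeq> q"
  shows "map f p \<simeq> map f q"
  using assms(4)
proof (induction rule: chain_eq.induct)
  case (chain_eq_Cons p q a)
  then show ?case using chain_map[OF f, of "a # p"] by (auto intro: chain_eq.chain_eq_Cons)
next
  case (chain_eq_skip a b c p)
  then show ?case using chain_map[OF f, of "a # b # c # p"] f(3)
    by (auto intro: chain_eq.chain_eq_skip)
qed (auto intro: chain_eq.intros chain_map[OF f])

lemma phi_map_assms: "\<phi> ` P \<subseteq> P" "inj_on \<phi> P"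
  using phi_bij by (auto simp: bij_betw_def)

lemma chain_map_phi: "chain p \<Longrightarrow> chain (map \<phi> p)"
  and chain_eq_map_phi: "p \<simeq> q \<Longrightarrow> map \<phi> p \<simeq> map \<phi> q"
  using chain_map[OF phi_map_assms phi_mono] chain_eq_map[OF phi_map_assms phi_mono] by blast+

lemma chain_eq_map_phi_iff:
  assumes "chain p" "chain q"
  shows "map \<phi> p \<simeq> map \<phi> q \<longleftrightarrow> p \<simeq> q"
proof
  assume eq: "map \<phi> p \<simeq> map \<phi> q"
  let ?\<psi> = "inv_into P \<phi>"
  have psi: "bij_betw ?\<psi> P P" using bij_betw_inv_into[OF phi_bij] .
  have inv: "?\<psi> (\<phi> a) = a" "\<phi> (?\<psi> a) = a" if "a \<in> P" for a
    using that phi_bij by (auto simp: bij_betw_inv_into_left bij_betw_inv_into_right)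
  have "?\<psi> a \<sqsubseteq> ?\<psi> b" if "a \<sqsubseteq> b" for a b
    using phi_le_iff[of "?\<psi> a" "?\<psi> b"] that le_carrier[OF that] inv psi
    by (auto simp: bij_betw_def)
  then have "map ?\<psi> (map \<phi> p) \<simeq> map ?\<psi> (map \<phi> q)"
    using chain_eq_map[OF _ _ _ eq, of ?\<psi>] psi by (auto simp: bij_betw_def)
  moreover have "map ?\<psi> (map \<phi> r) = r" if "chain r" for r
    using chain_in_carrier[OF that] inv by (auto simp: map_idI)
  ultimately show "p \<simeq> q" using assms by simp
qed (rule chain_eq_map_phi)

text \<open>Up to equivalence, \<open>stab p\<close> is \<open>p\<close> followed by the step from its last element \<open>y\<close> to \<open>\<phi> y\<close>.
  Placing the additional step in front makes it amenable to left cancellation.\<close>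

definition stab :: "'a list \<Rightarrow> 'a list" where
  "stab p = hd p # map \<phi> p"

lemma hd_map_phi: "chain p \<Longrightarrow> hd (map \<phi> p) = \<phi> (hd p)"
  by (auto simp: hd_map chain_neq_Nil)

lemma hd_stab [simp]: "hd (stab p) = hd p"
  by (simp add: stab_def)

lemma stab_eq_ext: "chain p \<Longrightarrow> stab p = ext (hd p) (map \<phi> p)"
  using phi_neq chain_hd by (simp add: stab_def ext_def hd_map_phi)

lemma chain_stab: "chain p \<Longrightarrow> chain (stab p)"
  using chain_ext[OF chain_map_phi] le_phi chain_hd by (simp add: stab_eq_ext hd_map_phi)

lemma stab_cong: "p \<simeq> q \<Longrightarrow> stab p \<simeq> stab q"
  using ext_cong[OF chain_eq_map_phi, of p q "hd p"] chain_eq_chain[of p q] chain_eq_hd[of p q]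
    le_phi chain_hd by (simp add: stab_eq_ext hd_map_phi)

text \<open>Left cancellation removes the step that \<open>stab\<close> puts in front; what remains
  is pulled back along the automorphism \<open>\<phi>\<close>.\<close>

lemma stab_cancel: "stab p \<simeq> stab q \<Longrightarrow> chain p \<Longrightarrow> chain q \<Longrightarrow> p \<simeq> q"
  using left_cancel[of "hd p" "map \<phi> p" "map \<phi> q"] chain_eq_hd[of "stab p" "stab q"]
  by (simp add: stab_def chain_map_phi hd_map_phi chain_eq_map_phi_iff)

lemma map_phi_ext: "chain p \<Longrightarrow> a \<in> P \<Longrightarrow> map \<phi> (ext a p) = ext (\<phi> a) (map \<phi> p)"
  using phi_inj chain_hd by (auto simp: ext_def hd_map_phi)

text \<open>The square from \<open>a\<close> to \<open>\<phi> b\<close> through \<open>b\<close> and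
  through \<open>\<phi> a\<close> commutes, because the diagonal
  \<open>b \<sqsubseteq> \<phi> a\<close> cuts it into two triangles whose steps merge. This is
  naturality of the step from \<open>x\<close> to \<open>\<phi> x\<close>.\<close>

lemma square:
  assumes "a \<sqsubseteq> b" "chain q" "hd q = \<phi> b"
  shows "ext a (ext b q) \<simeq> ext a (ext (\<phi> a) q)"
proof -
  have P: "a \<in> P" "b \<in> P" using assms(1) le_carrier by blast+
  have b: "b \<sqsubseteq> \<phi> a" "\<phi> a \<sqsubseteq> \<phi> b" "b \<sqsubseteq> \<phi> b" "a \<sqsubseteq> \<phi> a"
    using assms(1) phi_top phi_mono le_phi P by auto
  have "ext b q \<simeq> ext b (ext (\<phi> a) q)"
    using chain_eq_sym[OF ext_ext[OF assms(2) b(1)]] b assms(3) by simp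
  then have "ext a (ext b q) \<simeq> ext a (ext b (ext (\<phi> a) q))"
    using ext_cong assms(1) by simp
  also have "\<dots> \<simeq> ext a (ext (\<phi> a) q)"
    using ext_ext[OF chain_ext[OF assms(2)], of "\<phi> a" a b] b assms by simp
  finally show ?thesis .
qed

lemma stab_ext:
  assumes "chain p" "a \<sqsubseteq> hd p"
  shows "stab (ext a p) \<simeq> ext a (stab p)"
proof -
  have "a \<in> P" using assms(2) le_carrier by blast
  then have "stab (ext a p) = ext a (ext (\<phi> a) (map \<phi> p))"
    using stab_eq_ext[OF chain_ext[OF assms]] assms(1) by (simp add: map_phi_ext)
  then show ?thesis
    using chain_eq_sym[OF square[OF assms(2) chain_map_phi]] assms(1)
    by (simp add: hd_map_phi stab_eq_ext)
qed

subsection \<open>Lifting edge paths to chains\<close>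

text \<open>An edge from \<open>a\<close> down to \<open>hd p\<close> is replaced by the step \<open>a \<sqsubseteq> \<phi> (hd p)\<close>. Stabilizing along
  upward edges too makes the lift of a path with \<open>n\<close> edges end in \<open>\<phi>\<^sup>n\<close> of its last vertex.\<close>

definition prepend :: "'a \<Rightarrow> 'a list \<Rightarrow> 'a list" where
  "prepend a p = (if a \<sqsubseteq> hd p then stab (ext a p) else ext a (map \<phi> p))"

lemma prepend_fwd: "a \<sqsubseteq> hd p \<Longrightarrow> prepend a p = stab (ext a p)"
  by (simp add: prepend_def)

lemma prepend_bwd:
  assumes "chain p" "hd p \<sqsubseteq> a"
  shows "prepend a p = ext a (map \<phi> p)"
proof (cases "a \<sqsubseteq> hd p")
  case True
  then have "a = hd p" using assms(2) le_antisym by blast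
  then show ?thesis using True assms(1) by (simp add: prepend_def stab_eq_ext)
qed (simp add: prepend_def)

lemma hd_prepend [simp]: "hd (prepend a p) = a"
  by (simp add: prepend_def)

lemma chain_prepend:
  assumes "chain p" "a \<sqsubseteq> hd p \<or> hd p \<sqsubseteq> a"
  shows "chain (prepend a p)"
  using assms chain_stab[OF chain_ext] chain_ext[OF chain_map_phi] phi_top
  by (auto simp: prepend_fwd prepend_bwd hd_map_phi)

lemma prepend_cong:
  assumes "p \<simeq> q" "a \<sqsubseteq> hd p \<or> hd p \<sqsubseteq> a"
  shows "prepend a p \<simeq> prepend a q"
proof -
  note inv = chain_eq_chain[OF assms(1)] chain_eq_hd[OF assms(1)]
  show ?thesis
    using assms(2)
  proof
    assume "a \<sqsubseteq> hd p"
    then show ?thesis using stab_cong[OF ext_cong[OF assms(1)]] inv by (simp add: prepend_fwd)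
  next
    assume "hd p \<sqsubseteq> a"
    then show ?thesis
      using ext_cong[OF chain_eq_map_phi[OF assms(1)], of a] inv phi_top
      by (simp add: prepend_bwd hd_map_phi)
  qed
qed

lemma prepend_stab:
  assumes "chain p" "a \<sqsubseteq> hd p \<or> hd p \<sqsubseteq> a"
  shows "prepend a (stab p) \<simeq> stab (prepend a p)"
  using assms(2)
proof
  assume a: "a \<sqsubseteq> hd p"
  then show ?thesis
    using stab_cong[OF chain_eq_sym[OF stab_ext[OF assms(1) a]]] by (simp add: prepend_fwd)
next
  assume a: "hd p \<sqsubseteq> a"
  have "map \<phi> (stab p) = stab (map \<phi> p)"
    using assms(1) by (simp add: stab_def hd_map_phi)
  then show ?thesis
    using chain_eq_sym[OF stab_ext[OF chain_map_phi[OF assms(1)]], of a] a assms(1) phi_top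
    by (simp add: prepend_bwd chain_stab hd_map_phi)
qed

text \<open>The path through \<open>b\<close> has one more edge, hence the additional stabilization on the right.
  Together with comparability, \<open>le_skip\<close> says that the three vertices form a chain.\<close>

lemma prepend_prepend:
  assumes p: "chain p" and c: "hd p = c"
    and cmp: "a \<sqsubseteq> b \<or> b \<sqsubseteq> a" "b \<sqsubseteq> c \<or> c \<sqsubseteq> b" "a \<sqsubseteq> c \<or> c \<sqsubseteq> a"
    and le_skip: "\<And>x y z. {x, y, z} \<subseteq> {a, b, c} \<Longrightarrow> x \<sqsubseteq> y \<Longrightarrow> y \<sqsubseteq> z \<Longrightarrow> x \<sqsubseteq> z"
  shows "prepend a (prepend b p) \<simeq> stab (prepend a p)"
proof -
  have P: "a \<in> P" "b \<in> P" "c \<in> P" using cmp le_carrier by blast+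
  define q where "q = map \<phi> p"
  have q: "chain q" "hd q = \<phi> c" using p c by (auto simp: q_def chain_map_phi hd_map_phi)
  have mext: "map \<phi> (ext x p) = ext (\<phi> x) q" if "x \<in> P" for x
    using map_phi_ext[OF p that] by (simp add: q_def)
  have stabp: "stab p = ext c q" using stab_eq_ext[OF p] c by (simp add: q_def)
  have map_stab: "map \<phi> (stab r) = stab (map \<phi> r)" if "chain r" for r
    using that by (simp add: stab_def hd_map_phi)
  \<comment> \<open>The three vertices occur in one of six linear orders; in each,
    \<open>le_skip\<close> supplies the third relation needed for merging steps.\<close>
  consider (abc) "a \<sqsubseteq> b" "b \<sqsubseteq> c" | (acb) "a \<sqsubseteq> c" "c \<sqsubseteq> b" | (bac) "b \<sqsubseteq> a" "a \<sqsubseteq> c"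
    | (bca) "b \<sqsubseteq> c" "c \<sqsubseteq> a" | (cab) "c \<sqsubseteq> a" "a \<sqsubseteq> b" | (cba) "c \<sqsubseteq> b" "b \<sqsubseteq> a"
    using cmp by blast
  then show ?thesis
  proof cases
    case abc
    then have ac: "a \<sqsubseteq> c" using le_skip by blast
    have chb: "chain (ext b p)" using chain_ext p c abc by simp
    have "prepend a (prepend b p) = stab (ext a (stab (ext b p)))"
      using abc c by (simp add: prepend_fwd)
    also have "\<dots> \<simeq> stab (stab (ext a (ext b p)))"
      using stab_cong[OF chain_eq_sym[OF stab_ext[OF chb]]] abc by simp
    also have "\<dots> \<simeq> stab (stab (ext a p))"
      using stab_cong[OF stab_cong[OF ext_ext[OF p]]] abc ac c by simp
    finally show ?thesis using ac c by (simp add: prepend_fwd)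
  next
    case acb
    then have ab: "a \<sqsubseteq> b" using le_skip by blast
    have chb: "chain (ext b q)" and b: "b \<sqsubseteq> \<phi> c" using chain_ext q acb phi_top by auto
    have "ext a (ext b q) \<simeq> ext a (ext c (ext b q))"
      using chain_eq_sym[OF ext_ext[OF chb, of a c]] acb ab by simp
    also have "\<dots> \<simeq> ext a (ext c q)"
      using ext_cong[OF ext_ext[OF q(1), of c b]] acb b le_phi P q by simp
    also have "\<dots> \<simeq> stab (ext a p)"
      using chain_eq_sym[OF stab_ext[OF p]] acb c stabp by simp
    finally have "stab (ext a (ext b q)) \<simeq> stab (stab (ext a p))" by (rule stab_cong)
    then show ?thesis
      using acb c ab p by (simp add: prepend_fwd prepend_bwd q_def)
  next
    case bac
    then have bc: "b \<sqsubseteq> c" using le_skip by blast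
    have chb: "chain (ext b p)" using chain_ext p c bc by simp
    have chb': "chain (ext (\<phi> b) q)" using chain_ext q phi_mono[OF bc] by simp
    have cha: "chain (ext (\<phi> a) q)" using chain_ext q phi_mono[OF bac(2)] by simp
    have ab: "a \<sqsubseteq> \<phi> b" "\<phi> b \<sqsubseteq> \<phi> a" "a \<sqsubseteq> \<phi> a" using bac phi_top phi_mono le_phi P by auto
    have "ext a (ext (\<phi> b) q) \<simeq> ext a (ext (\<phi> b) (ext (\<phi> a) q))"
      using ext_cong[OF chain_eq_sym[OF ext_ext[OF q(1), of "\<phi> b" "\<phi> a"]], of a] ab q
        phi_mono[OF bac(2)] phi_mono[OF bc] by simp
    also have "\<dots> \<simeq> ext a (ext (\<phi> a) q)"
      using ext_ext[OF cha, of a "\<phi> b"] ab by simp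
    also have "\<dots> = stab (ext a p)"
      using stab_eq_ext[OF chain_ext[OF p]] bac c P p by (simp add: map_phi_ext q_def)
    finally have inner: "ext a (ext (\<phi> b) q) \<simeq> stab (ext a p)" .
    have "prepend a (prepend b p) = ext a (stab (ext (\<phi> b) q))"
      using bac bc c P chb by (simp add: prepend_fwd prepend_bwd chain_stab map_stab mext)
    also have "\<dots> \<simeq> stab (ext a (ext (\<phi> b) q))"
      using chain_eq_sym[OF stab_ext[OF chb']] ab by simp
    also have "\<dots> \<simeq> stab (stab (ext a p))"
      using inner by (rule stab_cong)
    finally show ?thesis using bac c by (simp add: prepend_fwd)
  next
    case bca
    then have ba: "b \<sqsubseteq> a" using le_skip by blast
    have chb: "chain (ext b p)" using chain_ext p c bca by simp
    have chb': "chain (ext (\<phi> b) q)" using chain_ext q phi_mono[OF bca(1)] by simp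
    have ab: "a \<sqsubseteq> \<phi> b" using ba phi_top by auto
    have "prepend a (prepend b p) = ext a (stab (ext (\<phi> b) q))"
      using bca ba c P chb by (simp add: prepend_fwd prepend_bwd chain_stab map_stab mext)
    also have "\<dots> \<simeq> stab (ext a (ext (\<phi> b) q))"
      using chain_eq_sym[OF stab_ext[OF chb']] ab by simp
    also have "\<dots> \<simeq> stab (ext a q)"
      using stab_cong[OF ext_ext[OF q(1), of a "\<phi> b"]] ab q phi_mono[OF bca(1)] phi_top[OF bca(2)] by simp
    finally show ?thesis using bca c p by (simp add: prepend_bwd q_def)
  next
    case cab
    then have cb: "c \<sqsubseteq> b" using le_skip by blast
    have "prepend a (prepend b p) = stab (ext a (ext b q))"
      using cab c cb p by (simp add: prepend_fwd prepend_bwd q_def)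
    also have "\<dots> \<simeq> stab (ext a q)"
      using stab_cong[OF ext_ext[OF q(1), of a b]] cab cb phi_top q by simp
    finally show ?thesis using cab c p by (simp add: prepend_bwd q_def)
  next
    case cba
    then have ca: "c \<sqsubseteq> a" using le_skip by blast
    \<comment> \<open>Two descending edges apply \<open>\<phi>\<close> twice to
      \<open>p\<close>.\<close>
    define s where "s = map \<phi> q"
    have s: "chain s" "hd s = \<phi> (\<phi> c)" using q by (auto simp: s_def chain_map_phi hd_map_phi)
    have b: "\<phi> c \<sqsubseteq> \<phi> b" "\<phi> b \<sqsubseteq> \<phi> (\<phi> c)" "\<phi> c \<sqsubseteq> \<phi> (\<phi> c)"
      using cba phi_mono phi_top le_phi phi_carrier P by auto
    have a: "a \<sqsubseteq> \<phi> c" "a \<sqsubseteq> \<phi> b" using ca cba phi_top by auto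
    have chb: "chain (ext b q)" using chain_ext q cba phi_top by simp
    have chs: "chain (ext (\<phi> b) s)" using chain_ext s b by simp
    have "prepend a (prepend b p) = ext a (ext (\<phi> b) s)"
      using cba c p P q chb by (simp add: prepend_bwd map_phi_ext s_def flip: q_def)
    also have "\<dots> \<simeq> ext a (ext (\<phi> c) (ext (\<phi> b) s))"
      using chain_eq_sym[OF ext_ext[OF chs, of a "\<phi> c"]] a b by simp
    also have "\<dots> \<simeq> ext a (ext (\<phi> c) s)"
      using ext_cong[OF ext_ext[OF s(1), of "\<phi> c" "\<phi> b"]] a b s by simp
    also have "\<dots> \<simeq> stab (ext a q)"
      using chain_eq_sym[OF stab_ext[OF q(1)]] a q stab_eq_ext[OF q(1)] by (simp add: s_def)
    finally show ?thesis using ca c p by (simp add: prepend_bwd q_def)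
  qed
qed

section \<open>Lifts of walks and their behaviour under homotopy\<close>

fun lift_path :: "'a list \<Rightarrow> 'a list" where
  "lift_path [] = []"
| "lift_path [a] = [a]"
| "lift_path (a # b # w) = prepend a (lift_path (b # w))"

lemma lift_path_Cons: "w \<noteq> [] \<Longrightarrow> lift_path (a # w) = prepend a (lift_path w)"
  by (cases w) auto

definition walk :: "'a list \<Rightarrow> bool" where
  "walk w \<longleftrightarrow> w \<noteq> [] \<and> set w \<subseteq> P \<and> successively (\<lambda>a b. a \<sqsubseteq> b \<or> b \<sqsubseteq> a) w"

lemma walk_Cons: "walk (a # w) \<longleftrightarrow> (if w = [] then a \<in> P else (a \<sqsubseteq> hd w \<or> hd w \<sqsubseteq> a) \<and> walk w)"
  using le_carrier by (cases w) (auto simp: walk_def)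

lemma lift_path_chain: "walk w \<Longrightarrow> chain (lift_path w) \<and> hd (lift_path w) = hd w"
proof (induction w)
  case (Cons a w)
  then show ?case
    by (cases "w = []") (auto simp: walk_Cons lift_path_Cons intro!: chain_prepend)
qed (simp add: walk_def)

lemma chain_funpow_stab: "chain p \<Longrightarrow> chain ((stab ^^ m) p)"
  by (induction m) (auto intro: chain_stab)

lemma hd_funpow_stab [simp]: "hd ((stab ^^ m) p) = hd p"
  by (induction m) auto

lemma funpow_stab_cong: "p \<simeq> q \<Longrightarrow> (stab ^^ m) p \<simeq> (stab ^^ m) q"
  by (induction m) (auto intro: stab_cong)

lemma funpow_stab_cancel:
  "(stab ^^ m) p \<simeq> (stab ^^ m) q \<Longrightarrow> chain p \<Longrightarrow> chain q \<Longrightarrow> p \<simeq> q"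
proof (induction m)
  case (Suc m)
  then show ?case using stab_cancel chain_funpow_stab by simp
qed simp

lemma prepend_funpow_stab:
  assumes "chain p" "a \<sqsubseteq> hd p \<or> hd p \<sqsubseteq> a"
  shows "prepend a ((stab ^^ m) p) \<simeq> (stab ^^ m) (prepend a p)"
proof (induction m)
  case 0
  then show ?case using chain_prepend[OF assms] chain_eq_refl by simp
next
  case (Suc m)
  have "prepend a ((stab ^^ Suc m) p) \<simeq> stab (prepend a ((stab ^^ m) p))"
    using prepend_stab[OF chain_funpow_stab[OF assms(1)]] assms(2) by simp
  also have "\<dots> \<simeq> (stab ^^ Suc m) (prepend a p)"
    using stab_cong[OF Suc.IH] by simp
  finally show ?case .
qed

text \<open>A homotopy changes the number of edges, and with it the power of \<open>\<phi>\<close>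
  at which the lift ends. The balance of \<open>m\<close> and \<open>m'\<close> makes both
  stabilized lifts end at the same power, for nonempty lists with the same last vertex.\<close>

definition lift_eq :: "'a list \<Rightarrow> 'a list \<Rightarrow> bool" where
  "lift_eq w w' \<longleftrightarrow> (\<exists>m m'. m + length w = m' + length w' \<and>
     (stab ^^ m) (lift_path w) \<simeq> (stab ^^ m') (lift_path w'))"

lemma lift_eq_trans:
  assumes "lift_eq w w'" "lift_eq w' w''"
  shows "lift_eq w w''"
proof -
  obtain m m' k k' where
    m: "m + length w = m' + length w'" "(stab ^^ m) (lift_path w) \<simeq> (stab ^^ m') (lift_path w')" and
    k: "k + length w' = k' + length w''" "(stab ^^ k) (lift_path w') \<simeq> (stab ^^ k') (lift_path w'')"
    using assms unfolding lift_eq_def by blast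
  \<comment> \<open>The two equivalences are stabilized further, by \<open>k\<close> and by
    \<open>m'\<close>, so that they meet at the same stabilization of the lift of
    \<open>w'\<close>.\<close>
  have "(stab ^^ (k + m)) (lift_path w) \<simeq> (stab ^^ (k + m')) (lift_path w')"
    using funpow_stab_cong[OF m(2), of k] by (simp add: funpow_add)
  also have "(stab ^^ (k + m')) (lift_path w') = (stab ^^ m') ((stab ^^ k) (lift_path w'))"
    by (subst add.commute) (simp add: funpow_add)
  also have "\<dots> \<simeq> (stab ^^ (m' + k')) (lift_path w'')"
    using funpow_stab_cong[OF k(2), of m'] by (simp add: funpow_add)
  finally show ?thesis unfolding lift_eq_def
    using m(1) k(1) by (intro exI[of _ "k + m"] exI[of _ "m' + k'"]) auto
qed

lemma lift_eq_sym: "lift_eq w w' \<Longrightarrow> lift_eq w' w"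
  unfolding lift_eq_def by (blast intro: chain_eq_sym dest: HOL.sym)

lemma lift_eq_Cons:
  assumes "lift_eq w w'" "walk (a # w)" "walk (a # w')" "hd w = hd w'" "w \<noteq> []" "w' \<noteq> []"
  shows "lift_eq (a # w) (a # w')"
proof -
  obtain m m' where
    m: "m + length w = m' + length w'" "(stab ^^ m) (lift_path w) \<simeq> (stab ^^ m') (lift_path w')"
    using assms(1) unfolding lift_eq_def by blast
  have w: "walk w" "walk w'" "a \<sqsubseteq> hd w \<or> hd w \<sqsubseteq> a" using assms by (auto simp: walk_Cons)
  note L = lift_path_chain[OF w(1)] lift_path_chain[OF w(2)]
  have "(stab ^^ m) (prepend a (lift_path w)) \<simeq> prepend a ((stab ^^ m) (lift_path w))"
    using chain_eq_sym[OF prepend_funpow_stab] L w(3) by simp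
  also have "\<dots> \<simeq> prepend a ((stab ^^ m') (lift_path w'))"
    using prepend_cong[OF m(2)] L w(3) by simp
  also have "\<dots> \<simeq> (stab ^^ m') (prepend a (lift_path w'))"
    using prepend_funpow_stab L w(3) assms(4) by simp
  finally show ?thesis unfolding lift_eq_def
    using m(1) assms(5,6) by (intro exI[of _ m] exI[of _ m']) (simp add: lift_path_Cons)
qed

text \<open>A common lower bound of the simplex turns associativity into transitivity.\<close>

lemma simplex_le_skip:
  assumes "\<sigma> \<in> K" "{x, y, z} \<subseteq> \<sigma>" "x \<sqsubseteq> y" "y \<sqsubseteq> z"
  shows "x \<sqsubseteq> z"
proof -
  obtain o' where "\<forall>a\<in>\<sigma>. o' \<sqsubseteq> a \<and> (\<forall>b\<in>\<sigma>. a \<sqsubseteq> b \<or> b \<sqsubseteq> a)"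
    using simplex_chain[OF assms(1)] by blast
  then have "o' \<sqsubseteq> x" "o' \<sqsubseteq> y" "o' \<sqsubseteq> z" using assms(2) by auto
  then show ?thesis using le_assoc[of o' x y z] assms(3,4) by blast
qed

lemma simplex_comparable:
  "\<sigma> \<in> K \<Longrightarrow> a \<in> \<sigma> \<Longrightarrow> b \<in> \<sigma> \<Longrightarrow> a \<sqsubseteq> b \<or> b \<sqsubseteq> a"
  using simplex_chain by blast

text \<open>The additional invariants carry the induction: the middle list in \<open>trans\<close>
  must be known to be a walk, and in \<open>cons\<close> heads and emptiness must agree before an
  edge is added on both sides.\<close>

lemma edge_homotopic_lift_eq:
  assumes "edge_homotopic K w w'"
  shows "hd w = hd w' \<and> (walk w \<longleftrightarrow> walk w') \<and> (w = [] \<longleftrightarrow> w' = []) \<and> (walk w \<longrightarrow> lift_eq w w')"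
  using assms
proof (induction rule: edge_homotopic.induct)
  case (refl w)
  then show ?case
    using lift_path_chain chain_eq_refl by (auto simp: lift_eq_def intro!: exI[of _ 0])
next
  case (sym w w')
  then show ?case using lift_eq_sym[of w w'] by simp
next
  case (trans w w' w'')
  then show ?case using lift_eq_trans[of w w' w''] by simp
next
  case (cons w w' a)
  then show ?case
  proof (cases "w = []")
    case True
    then show ?thesis using cons
      by (auto simp: walk_Cons lift_eq_def intro!: exI[of _ 0] chain_eq_refl)
  next
    case False
    then show ?thesis using cons lift_eq_Cons[of w w' a] by (auto simp: walk_Cons)
  qed
next
  case (triangle a b c w)
  have cmp: "a \<sqsubseteq> b \<or> b \<sqsubseteq> a" "b \<sqsubseteq> c \<or> c \<sqsubseteq> b" "a \<sqsubseteq> c \<or> c \<sqsubseteq> a"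
    using simplex_comparable[OF triangle] by auto
  have walk: "walk (a # b # c # w) \<longleftrightarrow> walk (c # w)" "walk (a # c # w) \<longleftrightarrow> walk (c # w)"
    using cmp by (auto simp: walk_Cons)
  have "lift_eq (a # b # c # w) (a # c # w)" if "walk (c # w)"
  proof -
    have "prepend a (prepend b (lift_path (c # w))) \<simeq> stab (prepend a (lift_path (c # w)))"
      using lift_path_chain[OF that] cmp simplex_le_skip[OF triangle]
      by (intro prepend_prepend[of _ c]) auto
    \<comment> \<open>The list with one vertex fewer takes the one stabilization.\<close>
    then show ?thesis unfolding lift_eq_def by (intro exI[of _ 0] exI[of _ 1]) simp
  qed
  then show ?case using walk by simp
next
  case (degenerate a w)
  have a: "a \<sqsubseteq> a" using simplex_comparable[OF degenerate, of a a] by simp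
  then have walk: "walk (a # a # w) \<longleftrightarrow> walk (a # w)" by (auto simp: walk_Cons)
  have "lift_eq (a # a # w) (a # w)" if "walk (a # w)"
  proof -
    note L = lift_path_chain[OF that]
    have "prepend a (lift_path (a # w)) = stab (lift_path (a # w))"
      using L a ext_hd[of "lift_path (a # w)"] by (simp add: prepend_fwd)
    then show ?thesis unfolding lift_eq_def
      using L by (intro exI[of _ 0] exI[of _ 1]) (simp add: chain_eq_refl chain_stab)
  qed
  then show ?case using walk by simp
qed

section \<open>Uniqueness of chains with prescribed ends\<close>

lemma chain_walk: "chain p \<Longrightarrow> walk p"
  by (induction p rule: induct_list012) (auto simp: walk_Cons)

text \<open>All edges go up, so each of the \<open>length p - 1\<close> edges contributes its own
  step and one stabilization, which can be moved to the outside.\<close>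

lemma lift_path_of_chain: "chain p \<Longrightarrow> lift_path p \<simeq> (stab ^^ (length p - 1)) p"
proof (induction p rule: induct_list012)
  case (3 a b p)
  let ?q = "b # p"
  have q: "chain ?q" "a \<sqsubseteq> b" "a \<noteq> b" using "3.prems" by auto
  have "lift_path (a # ?q) \<simeq> prepend a ((stab ^^ length p) ?q)"
    using prepend_cong[OF "3.IH"(2)[OF q(1)], of a] q lift_path_chain[OF chain_walk[OF q(1)]] by simp
  also have "\<dots> \<simeq> (stab ^^ length p) (prepend a ?q)"
    using prepend_funpow_stab[OF q(1)] q by simp
  also have "\<dots> = (stab ^^ Suc (length p)) (a # ?q)"
    using q by (simp add: prepend_fwd ext_def funpow_swap1)
  finally show ?case by simp
qed (auto intro: chain_eq_refl)

lemma walk_edge_path: "walk w \<Longrightarrow> edge_path K w"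
proof (induction w rule: induct_list012)
  case (3 a b w)
  then have "{a, b} \<in> K" using edge_simplex[of a b] edge_simplex[of b a] by (auto simp: walk_Cons insert_commute)
  then show ?case using 3 by (simp add: walk_Cons edge_path_def)
qed (simp_all add: walk_def edge_path_def)

lemma walk_rev: "walk w \<Longrightarrow> walk (rev w)"
  by (simp add: walk_def disj_commute)

lemma walk_append: "walk u \<Longrightarrow> walk v \<Longrightarrow> last u = hd v \<Longrightarrow> walk (u @ tl v)"
  by (cases v; cases "tl v") (auto simp: walk_def successively_append_iff successively_Cons)

text \<open>The loop \<open>rev v\<close> followed by \<open>v\<close> is inserted at the end of
  \<open>u\<close>; then \<open>u\<close> followed by \<open>rev v\<close> is a loop and contracts,
  leaving \<open>v\<close>.\<close>

lemma walks_edge_homotopic: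
  assumes u: "walk u" and v: "walk v" and "hd u = hd v" "last u = last v"
  shows "edge_homotopic K u v"
proof -
  have ne: "u \<noteq> []" "v \<noteq> []" using u v by (auto simp: walk_def)
  have loop: "edge_homotopic K w [hd w]" if "walk w" "hd w = last w" for w
    using loop_trivial walk_edge_path that by blast
  have last_app: "last (x @ tl y) = last y" if "y \<noteq> []" "last x = hd y" for x y :: "'a list"
    using that by (cases y) auto
  let ?y = "last v"
  have "walk (rev v @ tl v)" and h1: "hd (rev v @ tl v) = ?y" and "last (rev v @ tl v) = ?y"
    using walk_append[OF walk_rev[OF v] v] last_app[of v "rev v"] ne
    by (auto simp: last_rev hd_append hd_rev)
  then have "edge_homotopic K (rev v @ tl v) [?y]"
    using loop[of "rev v @ tl v"] by simp
  then have "edge_homotopic K (butlast u @ [?y]) (butlast u @ (rev v @ tl v))"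
    by (rule edge_homotopic_append_left[OF edge_homotopic.sym])
  moreover have "butlast u @ [?y] = u" using ne assms(4) append_butlast_last_id[of u] by simp
  moreover have "butlast u @ rev v = u @ tl (rev v)"
  proof -
    have "rev v = ?y # tl (rev v)" using ne by (metis hd_rev list.collapse rev_is_Nil_conv)
    then have "butlast u @ rev v = (butlast u @ [?y]) @ tl (rev v)" by simp
    then show ?thesis using \<open>butlast u @ [?y] = u\<close> by simp
  qed
  ultimately have 1: "edge_homotopic K u ((u @ tl (rev v)) @ tl v)"
    by (metis append_assoc)
  have "walk (u @ tl (rev v))" "hd (u @ tl (rev v)) = hd u" "last (u @ tl (rev v)) = hd u"
    using walk_append[OF u walk_rev[OF v]] last_app[of "rev v" u] ne assms(3,4)
    by (auto simp: hd_rev last_rev)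
  then have "edge_homotopic K (u @ tl (rev v)) [hd u]" using loop by metis
  then have "edge_homotopic K ((u @ tl (rev v)) @ tl v) ([hd u] @ tl v)"
    by (rule edge_homotopic_append_right)
  moreover have "[hd u] @ tl v = v" using assms(3) ne by simp
  ultimately show ?thesis using edge_homotopic.trans[OF 1] by simp
qed

text \<open>The chains are homotopic as edge paths, so their lifts agree after stabilization. Lifts
  of chains are themselves stabilizations, and \<open>stab\<close> can be cancelled.\<close>

theorem chain_unique:
  assumes "chain u" "chain v" "hd u = hd v" "last u = last v"
  shows "u \<simeq> v"
proof -
  have "lift_eq u v"
    using edge_homotopic_lift_eq[OF walks_edge_homotopic] assms chain_walk by blast
  then obtain m m' where m: "m + length u = m' + length v"
      "(stab ^^ m) (lift_path u) \<simeq> (stab ^^ m') (lift_path v)"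
    unfolding lift_eq_def by blast
  \<comment> \<open>The total number of stabilizations of \<open>u\<close>; the balance of
    \<open>m\<close> and \<open>m'\<close> gives the same number for \<open>v\<close>.\<close>
  define N where "N = m + (length u - 1)"
  have N: "N = m' + (length v - 1)" using m(1) assms(1,2) chain_neq_Nil[of u] chain_neq_Nil[of v]
    unfolding N_def by (cases u; cases v) auto
  have "(stab ^^ N) u \<simeq> (stab ^^ m) (lift_path u)"
    using funpow_stab_cong[OF chain_eq_sym[OF lift_path_of_chain[OF assms(1)]], of m]
    by (simp add: N_def funpow_add)
  also note m(2)
  also have "(stab ^^ m') (lift_path v) \<simeq> (stab ^^ N) v"
    using funpow_stab_cong[OF lift_path_of_chain[OF assms(2)], of m'] by (simp add: N funpow_add)
  finally show ?thesis using funpow_stab_cancel assms(1,2) by blast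
qed

subsection \<open>The generated partial order\<close>

abbreviation tle :: "'a \<Rightarrow> 'a \<Rightarrow> bool" (infix "\<preceq>" 50) where
  "tle \<equiv> le_t P le"

lemma tleI: "chain p \<Longrightarrow> hd p = a \<Longrightarrow> last p = b \<Longrightarrow> a \<preceq> b"
  unfolding le_t_def by blast

lemma tleE:
  assumes "a \<preceq> b"
  obtains p where "chain p" "hd p = a" "last p = b"
  using assms unfolding le_t_def by blast

lemma tle_carrier: "a \<preceq> b \<Longrightarrow> a \<in> P \<and> b \<in> P"
  by (auto elim!: tleE dest: chain_hd chain_last)

lemma tle_refl: "a \<in> P \<Longrightarrow> a \<preceq> a"
  using tleI[of "[a]"] by simp

lemma le_imp_tle: "a \<sqsubseteq> b \<Longrightarrow> a \<preceq> b"
  using tleI[of "[a, b]" a b] tle_refl le_carrier by (cases "a = b") auto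

lemma chain_append:
  "chain p \<Longrightarrow> chain q \<Longrightarrow> last p = hd q \<Longrightarrow> chain (p @ tl q) \<and> hd (p @ tl q) = hd p \<and>
     last (p @ tl q) = last q \<and> chain_length (p @ tl q) = chain_length p + chain_length q"
proof (induction p rule: induct_list012)
  case (2 a)
  then show ?case by (cases q) auto
next
  case (3 a b p)
  then show ?case by auto
qed simp

lemma tle_trans [trans]:
  assumes "a \<preceq> b" "b \<preceq> c"
  shows "a \<preceq> c"
proof -
  obtain p q where "chain p" "hd p = a" "last p = b" and "chain q" "hd q = b" "last q = c"
    using assms by (elim tleE)
  then show ?thesis using chain_append[of p q] by (intro tleI[of "p @ tl q"]) auto
qed

text \<open>Such a chain is equivalent to the one-element chain at its head, and equivalence
  preserves the absence of steps.\<close>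

lemma closed_chain_trivial:
  assumes "chain p" "hd p = last p"
  shows "tl p = []"
proof -
  have "p \<simeq> [hd p]" using assms chain_hd[OF assms(1)] by (intro chain_unique) auto
  from chain_eq_tl[OF this] show ?thesis by simp
qed

lemma tle_antisym:
  assumes "a \<preceq> b" "b \<preceq> a"
  shows "a = b"
proof -
  obtain p q where p: "chain p" "hd p = a" "last p = b" and q: "chain q" "hd q = b" "last q = a"
    using assms by (elim tleE)
  have "tl (p @ tl q) = []"
    using chain_append[OF p(1) q(1)] p q by (intro closed_chain_trivial) auto
  then have "p = [a]" using p chain_neq_Nil[OF p(1)] by (cases p) auto
  then show ?thesis using p by simp
qed

section \<open>The grading\<close>

text \<open>By \<open>chain_unique\<close> the choice of the chain does not affect the value, which
  is meaningful only if \<open>a \<preceq> b\<close>.\<close>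

definition grade :: "'a \<Rightarrow> 'a \<Rightarrow> nat" where
  "grade a b = chain_length (SOME p. chain p \<and> hd p = a \<and> last p = b)"

lemma grade_eq:
  assumes "chain p" "hd p = a" "last p = b"
  shows "grade a b = chain_length p"
proof -
  let ?q = "SOME p. chain p \<and> hd p = a \<and> last p = b"
  have "\<exists>p. chain p \<and> hd p = a \<and> last p = b" using assms by blast
  then have "chain ?q \<and> hd ?q = a \<and> last ?q = b" by (rule someI_ex)
  then have "?q \<simeq> p" using assms chain_unique[of ?q p] by simp
  then show ?thesis using chain_eq_length[of ?q p] by (simp add: grade_def)
qed

lemma grade_add:
  assumes "a \<preceq> b" "b \<preceq> c"
  shows "grade a c = grade a b + grade b c"
proof -
  obtain p q where p: "chain p" "hd p = a" "last p = b" and q: "chain q" "hd q = b" "last q = c"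
    using assms by (elim tleE)
  then show ?thesis
    using chain_append[OF p(1) q(1)] grade_eq[of p a b] grade_eq[of q b c] grade_eq[of "p @ tl q" a c] by simp
qed

lemma tle_first_step:
  assumes "a \<preceq> b" "a \<noteq> b"
  obtains c where "a \<sqsubseteq> c" "a \<noteq> c" "c \<preceq> b"
proof -
  obtain p where p: "chain p" "hd p = a" "last p = b" using assms(1) by (elim tleE)
  then obtain c q where "p = a # c # q"
    using assms(2) by (metis chain_neq_Nil last.simps list.exhaust list.sel(1))
  then show ?thesis using p that[of c] tleI[of "c # q"] by auto
qed

lemma grade_pos:
  assumes "a \<preceq> b" "a \<noteq> b"
  shows "0 < grade a b"
proof -
  obtain c where c: "a \<sqsubseteq> c" "a \<noteq> c" "c \<preceq> b" using assms by (rule tle_first_step)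
  then have "grade a c = l a c" using grade_eq[of "[a, c]"] le_carrier by simp
  then show ?thesis using grade_add[OF le_imp_tle[OF c(1)] c(3)] l_eq_0[OF c(1)] c(2) by simp
qed

section \<open>Joins and meets for the generated order\<close>

text \<open>The chains to \<open>f\<close> through \<open>b\<close> and through \<open>c\<close>,
  both started at \<open>a\<close>, have the same ends and are therefore equivalent; cancellation
  makes both factor through the local join.\<close>

lemma join_tle:
  assumes "a \<sqsubseteq> b" "a \<sqsubseteq> c" "b \<preceq> f" "c \<preceq> f"
  shows "join a b c \<preceq> f"
proof -
  obtain p q where p: "chain p" "hd p = b" "last p = f" and q: "chain q" "hd q = c" "last q = f"
    using assms(3,4) by (elim tleE)
  have ap: "a \<sqsubseteq> hd p" and aq: "a \<sqsubseteq> hd q" using assms(1,2) p q by simp_all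
  have "ext a p \<simeq> ext a q"
    using chain_ext[OF p(1) ap] chain_ext[OF q(1) aq] p q chain_neq_Nil[OF p(1)] chain_neq_Nil[OF q(1)]
    by (intro chain_unique) (simp_all add: last_ext)
  then obtain r where r: "chain r" "hd r = join a (hd p) (hd q)" "p \<simeq> ext (hd p) r"
    using chain_eq_ext_ext[OF _ p(1) ap q(1) aq] by blast
  have "last r = f" using chain_eq_last[OF r(3)] p(3) last_ext[OF chain_neq_Nil[OF r(1)]] by simp
  then show ?thesis using tleI[OF r(1)] r(2) p q by simp
qed

text \<open>Induction on \<open>grade x f\<close>. First steps \<open>b\<close> and \<open>c\<close>
  towards \<open>u\<close> and \<open>v\<close> are joined locally to \<open>m\<close>. Joining
  \<open>u\<close> and \<open>m\<close> over \<open>b\<close>, \<open>v\<close> and \<open>m\<close>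
  over \<open>c\<close>, and the two results over \<open>m\<close> are smaller problems. The bound
  \<open>f\<close> controls the induction, while the join found lies below every upper bound
  \<open>g\<close>.\<close>

lemma tle_lub_of_bounded:
  assumes "x \<preceq> u" "x \<preceq> v" "u \<preceq> f" "v \<preceq> f"
  shows "\<exists>w. u \<preceq> w \<and> v \<preceq> w \<and> (\<forall>g. u \<preceq> g \<and> v \<preceq> g \<longrightarrow> w \<preceq> g)"
  using assms
proof (induction "grade x f" arbitrary: x u v rule: less_induct)
  case less
  consider "u = x" | "v = x" | "x \<noteq> u" "x \<noteq> v" by blast
  then show ?case
  proof cases
    case 1
    then show ?thesis using less.prems tle_refl tle_carrier by blast
  next
    case 2
    then show ?thesis using less.prems tle_refl tle_carrier by blast
  next
    case 3
    obtain b where b: "x \<sqsubseteq> b" "x \<noteq> b" "b \<preceq> u" using less.prems(1) 3(1) by (rule tle_first_step)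
    obtain c where c: "x \<sqsubseteq> c" "x \<noteq> c" "c \<preceq> v" using less.prems(2) 3(2) by (rule tle_first_step)
    define m where "m = join x b c"
    have m: "x \<sqsubseteq> m" "b \<sqsubseteq> m" "c \<sqsubseteq> m" using join_props[OF b(1) c(1)] by (simp_all add: m_def)
    have xm: "x \<noteq> m" using m(2) b(1,2) le_antisym by blast
    have mleast: "m \<preceq> g" if "u \<preceq> g" "v \<preceq> g" for g
      unfolding m_def by (rule join_tle) (use b c that tle_trans in blast)+
    have mf: "m \<preceq> f" using mleast less.prems(3,4) .
    have dec: "grade y f < grade x f" if "x \<sqsubseteq> y" "x \<noteq> y" "y \<preceq> f" for y
      using grade_add[OF le_imp_tle[OF that(1)] that(3)] grade_pos[OF le_imp_tle[OF that(1)] that(2)]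
      by simp
    have bf: "b \<preceq> f" and cf: "c \<preceq> f" using b(3) c(3) less.prems(3,4) tle_trans by blast+
    obtain w1 where w1: "u \<preceq> w1" "m \<preceq> w1" "\<forall>g. u \<preceq> g \<and> m \<preceq> g \<longrightarrow> w1 \<preceq> g"
      using less.hyps[OF dec[OF b(1,2) bf] b(3) le_imp_tle[OF m(2)] less.prems(3) mf] by blast
    obtain w2 where w2: "v \<preceq> w2" "m \<preceq> w2" "\<forall>g. v \<preceq> g \<and> m \<preceq> g \<longrightarrow> w2 \<preceq> g"
      using less.hyps[OF dec[OF c(1,2) cf] c(3) le_imp_tle[OF m(3)] less.prems(4) mf] by blast
    have "w1 \<preceq> f" "w2 \<preceq> f" using w1(3) w2(3) less.prems(3,4) mf by blast+
    then obtain w where w: "w1 \<preceq> w" "w2 \<preceq> w" "\<forall>g. w1 \<preceq> g \<and> w2 \<preceq> g \<longrightarrow> w \<preceq> g"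
      using less.hyps[OF dec[OF m(1) xm mf] w1(2) w2(2)] by blast
    have "u \<preceq> w" "v \<preceq> w" using w1(1) w2(1) w(1,2) tle_trans by blast+
    moreover have "w \<preceq> g" if "u \<preceq> g" "v \<preceq> g" for g
      using w(3) w1(3) w2(3) mleast[OF that] that by blast
    ultimately show ?thesis by blast
  qed
qed

lemma funpow_phi_mono: "a \<sqsubseteq> b \<Longrightarrow> (\<phi> ^^ n) a \<sqsubseteq> (\<phi> ^^ n) b"
  by (induction n) (auto intro: phi_mono)

lemma funpow_phi_carrier: "a \<in> P \<Longrightarrow> (\<phi> ^^ n) a \<in> P"
  by (induction n) (auto intro: phi_carrier)

lemma tle_funpow_phi:
  assumes "a \<in> P" "n \<le> m"
  shows "(\<phi> ^^ n) a \<preceq> (\<phi> ^^ m) a"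
  using assms(2)
proof (induction m rule: dec_induct)
  case base
  show ?case by (rule tle_refl[OF funpow_phi_carrier[OF assms(1)]])
next
  case (step m)
  have "(\<phi> ^^ m) a \<preceq> (\<phi> ^^ Suc m) a"
    using le_imp_tle[OF le_phi[OF funpow_phi_carrier[OF assms(1)]]] by simp
  with step.IH show ?case by (rule tle_trans)
qed

text \<open>Each step out of \<open>a\<close> stays below \<open>\<phi> a\<close>. Powers of
  \<open>\<phi>\<close> at the starting point therefore provide common upper bounds.\<close>

lemma chain_last_tle_funpow: "chain p \<Longrightarrow> last p \<preceq> (\<phi> ^^ (length p - 1)) (hd p)"
proof (induction p rule: induct_list012)
  case (3 a b p)
  have "last (b # p) \<preceq> (\<phi> ^^ length p) b" using 3 by simp
  also have "(\<phi> ^^ length p) b \<preceq> (\<phi> ^^ length p) (\<phi> a)"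
    using "3.prems" by (intro le_imp_tle funpow_phi_mono phi_top) simp
  finally show ?case by (simp add: funpow_swap1)
qed (simp_all add: tle_refl)

lemma tle_bounded:
  assumes "x \<preceq> u" "x \<preceq> v"
  obtains f where "u \<preceq> f" "v \<preceq> f"
proof -
  have ex: "\<exists>n. u \<preceq> (\<phi> ^^ n) x" if u: "x \<preceq> u" for u
  proof -
    obtain p where "chain p" "hd p = x" "last p = u" using u by (rule tleE)
    then show ?thesis using chain_last_tle_funpow[of p] by blast
  qed
  obtain n m where nm: "u \<preceq> (\<phi> ^^ n) x" "v \<preceq> (\<phi> ^^ m) x"
    using ex[OF assms(1)] ex[OF assms(2)] by blast
  have "x \<in> P" using tle_carrier[OF assms(1)] by blast
  then have "(\<phi> ^^ n) x \<preceq> (\<phi> ^^ max n m) x" "(\<phi> ^^ m) x \<preceq> (\<phi> ^^ max n m) x"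
    by (simp_all add: tle_funpow_phi)
  then show ?thesis by (rule that[OF tle_trans[OF nm(1)] tle_trans[OF nm(2)]])
qed

lemma tle_ex_lub:
  assumes "x \<preceq> u" "x \<preceq> v"
  shows "\<exists>w. x \<preceq> w \<and> u \<preceq> w \<and> v \<preceq> w \<and> (\<forall>g. u \<preceq> g \<and> v \<preceq> g \<longrightarrow> w \<preceq> g)"
proof -
  obtain f where f: "u \<preceq> f" "v \<preceq> f" using tle_bounded[OF assms] by blast
  obtain w where w: "u \<preceq> w" "v \<preceq> w" "\<forall>g. u \<preceq> g \<and> v \<preceq> g \<longrightarrow> w \<preceq> g"
    using tle_lub_of_bounded[OF assms f] by blast
  then show ?thesis using tle_trans[OF assms(1) w(1)] by blast
qed

text \<open>Common lower bounds above \<open>x\<close> have grade at most \<open>grade x u\<close>,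
  so one of them, \<open>w\<close>, has maximal grade. Its join with any other is again such a bound
  and hence equals \<open>w\<close>.\<close>

lemma tle_ex_glb:
  assumes "x \<preceq> u" "x \<preceq> v"
  shows "\<exists>w. x \<preceq> w \<and> w \<preceq> u \<and> w \<preceq> v \<and> (\<forall>g. x \<preceq> g \<and> g \<preceq> u \<and> g \<preceq> v \<longrightarrow> g \<preceq> w)"
proof -
  let ?B = "\<lambda>d. x \<preceq> d \<and> d \<preceq> u \<and> d \<preceq> v"
  have "?B x" using assms tle_refl[of x] tle_carrier[OF assms(1)] by simp
  moreover have "grade x d \<le> grade x u" if "?B d" for d
    using grade_add[of x d u] that by simp
  ultimately obtain w where w: "?B w" "\<And>d. ?B d \<Longrightarrow> grade x d \<le> grade x w"
    \<comment> \<open>The successor turns the weak bound on the grades into a strict one.\<close>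
    using ex_has_greatest_nat[of ?B x "grade x" "Suc (grade x u)"] by (auto simp: less_Suc_eq_le)
  have "g \<preceq> w" if g: "?B g" for g
  proof -
    obtain s where s: "x \<preceq> s" "g \<preceq> s" "w \<preceq> s" "\<forall>f. g \<preceq> f \<and> w \<preceq> f \<longrightarrow> s \<preceq> f"
      using tle_ex_lub[of x g w] g w(1) by blast
    then have "grade x s \<le> grade x w" using w g by blast
    moreover have "grade x s = grade x w + grade w s" using grade_add w(1) s(3) by blast
    ultimately have "w = s" using grade_pos[OF s(3)] by auto
    then show ?thesis using s(2) by simp
  qed
  then show ?thesis using w(1) by blast
qed

section \<open>Duality\<close>

text \<open>A lower bound \<open>x\<close> of a simplex is replaced by \<open>\<phi> x\<close>, an
  upper bound by \<open>phi_top\<close>. Simplices are unoriented, so \<open>K\<close> and its loops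
  stay the same, and the axioms on \<open>\<phi>\<close> transpose through
  \<open>psi_le\<close>.\<close>

lemma garside_germ_converse:
  assumes ex_meet: "\<And>a b c. b \<sqsubseteq> a \<Longrightarrow> c \<sqsubseteq> a \<Longrightarrow>
      \<exists>j. j \<sqsubseteq> a \<and> j \<sqsubseteq> b \<and> j \<sqsubseteq> c \<and> (\<forall>m. m \<sqsubseteq> a \<and> m \<sqsubseteq> b \<and> m \<sqsubseteq> c \<longrightarrow> m \<sqsubseteq> j)"
  shows "garside_germ P (\<lambda>a b. b \<sqsubseteq> a) (inv_into P \<phi>) (\<lambda>a b. l b a) K"
proof -
  let ?\<psi> = "inv_into P \<phi>"
  have inv: "?\<psi> a \<in> P" "\<phi> (?\<psi> a) = a" if "a \<in> P" for a
    using that phi_bij bij_betw_inv_into[OF phi_bij]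
    by (auto simp: bij_betw_inv_into_right bij_betw_def)
  have psi_le: "?\<psi> a \<sqsubseteq> b \<longleftrightarrow> a \<sqsubseteq> \<phi> b" if "a \<in> P" "b \<in> P" for a b
    using phi_le_iff[of "?\<psi> a" b] inv that by simp
  show ?thesis
  proof
    fix \<sigma> assume \<sigma>: "\<sigma> \<in> K"
    then obtain x where "\<forall>a\<in>\<sigma>. x \<sqsubseteq> a \<and> (\<forall>b\<in>\<sigma>. a \<sqsubseteq> b \<or> b \<sqsubseteq> a)"
      using simplex_chain by blast
    then show "\<exists>x. \<forall>a\<in>\<sigma>. a \<sqsubseteq> x \<and> (\<forall>b\<in>\<sigma>. b \<sqsubseteq> a \<or> a \<sqsubseteq> b)"
      using phi_top by (intro exI[of _ "\<phi> x"]) blast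
  next
    fix a b c assume "b \<sqsubseteq> a" "c \<sqsubseteq> a"
    then show "\<exists>j. j \<sqsubseteq> a \<and> j \<sqsubseteq> b \<and> j \<sqsubseteq> c \<and> (\<forall>m. m \<sqsubseteq> a \<and> m \<sqsubseteq> b \<and> m \<sqsubseteq> c \<longrightarrow> m \<sqsubseteq> j)"
      by (rule ex_meet)
  next
    fix a b assume ab: "a \<in> P" "b \<in> P"
    then show "?\<psi> b \<sqsubseteq> ?\<psi> a \<longleftrightarrow> b \<sqsubseteq> a"
      using psi_le[of b "?\<psi> a"] inv by simp
  next
    fix a b assume "b \<sqsubseteq> a"
    then show "?\<psi> a \<sqsubseteq> b" using psi_le phi_top le_carrier by blast
  next
    fix a assume a: "a \<in> P"
    then show "?\<psi> a \<sqsubseteq> a" "?\<psi> a \<noteq> a" using psi_le le_phi phi_neq inv by (blast, metis)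
  next
    fix a b c d assume "b \<sqsubseteq> a" "c \<sqsubseteq> b" "d \<sqsubseteq> c" "d \<sqsubseteq> a"
    then show "c \<sqsubseteq> a \<longleftrightarrow> d \<sqsubseteq> b" using le_assoc[of d c b a] by blast
  next
    fix a b c assume "b \<sqsubseteq> a" "c \<sqsubseteq> b" "c \<sqsubseteq> a"
    then show "l c a = l b a + l c b" using l_add[of c b a] by simp
  next
    fix a b assume "b \<sqsubseteq> a"
    then show "l b a = 0 \<longleftrightarrow> a = b" "{a, b} \<in> K"
      using l_eq_0[of b a] edge_simplex[of b a] by (auto simp: insert_commute)
  next
    show "bij_betw ?\<psi> P P" using bij_betw_inv_into[OF phi_bij] .
  next
    fix a b assume "b \<sqsubseteq> a"
    then show "a \<in> P \<and> b \<in> P" using le_carrier by blast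
  next
    fix a b assume "b \<sqsubseteq> a" "a \<sqsubseteq> b"
    then show "a = b" using le_antisym by blast
  next
    fix w assume "edge_path K w" "hd w = last w"
    then show "edge_homotopic K w [hd w]" by (rule loop_trivial)
  qed (rule le_refl)
qed

end

section \<open>Weakly ordered sets with a shift\<close>

lemma le_t_converse: "le_t P (\<lambda>a b. R b a) a b \<longleftrightarrow> le_t P R b a"
proof -
  have "le_t P (\<lambda>a b. R b a) a b" if R: "le_t P R b a" for R :: "'a \<Rightarrow> 'a \<Rightarrow> bool" and a b
  proof -
    obtain cs where cs: "weak_chain P R cs" "hd cs = b" "last cs = a"
      using R unfolding le_t_def by blast
    then have "successively (\<lambda>a b. R a b \<and> b \<noteq> a) cs"
      unfolding weak_chain_def by (metis (mono_tags, lifting) successively_mono)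
    then have "weak_chain P (\<lambda>a b. R b a) (rev cs)"
      using cs(1) by (simp add: weak_chain_def)
    moreover have "hd (rev cs) = a" "last (rev cs) = b"
      using cs by (auto simp: weak_chain_def hd_rev last_rev)
    ultimately show ?thesis unfolding le_t_def by blast
  qed
  from this[of R b a] this[of "\<lambda>a b. R b a" a b] show ?thesis by blast
qed

lemma lattice_onI:
  assumes "\<And>a. a \<in> A \<Longrightarrow> R a a"
    and "\<And>a b. a \<in> A \<Longrightarrow> b \<in> A \<Longrightarrow> R a b \<Longrightarrow> R b a \<Longrightarrow> a = b"
    and "\<And>a b c. a \<in> A \<Longrightarrow> b \<in> A \<Longrightarrow> c \<in> A \<Longrightarrow> R a b \<Longrightarrow> R b c \<Longrightarrow> R a c"
    and "\<And>a b. a \<in> A \<Longrightarrow> b \<in> A \<Longrightarrow> \<exists>s\<in>A. R a s \<and> R b s \<and> (\<forall>m\<in>A. R a m \<and> R b m \<longrightarrow> R s m)"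
    and "\<And>a b. a \<in> A \<Longrightarrow> b \<in> A \<Longrightarrow> \<exists>s\<in>A. R s a \<and> R s b \<and> (\<forall>m\<in>A. R m a \<and> R m b \<longrightarrow> R m s)"
  shows "lattice_on A R"
proof (unfold_locales, goal_cases)
  case (4 x)
  then show ?case using assms(1) by simp
next
  case (5 x y)
  then show ?case using assms(2)[of x y] by simp
next
  case (6 x y z)
  then show ?case using assms(3)[of x y z] by simp
next
  case (9 x y)
  then show ?case using assms(4)[of x y] by (auto simp: least_def Upper_def)
next
  case (10 x y)
  then show ?case using assms(5)[of x y] by (auto simp: greatest_def Lower_def)
qed (simp_all)

lemma lattice_on_ex_lub:
  assumes "lattice_on A R" "a \<in> A" "b \<in> A"
  shows "\<exists>s\<in>A. R a s \<and> R b s \<and> (\<forall>m\<in>A. R a m \<and> R b m \<longrightarrow> R s m)"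
proof -
  interpret L: Lattice.lattice "\<lparr>carrier = A, eq = (=), le = R\<rparr>" by (rule assms(1))
  show ?thesis using L.sup_of_two_exists[of a b] assms(2,3)
    by (auto simp: least_def Upper_def)
qed

lemma lattice_on_ex_glb:
  assumes "lattice_on A R" "a \<in> A" "b \<in> A"
  shows "\<exists>s\<in>A. R s a \<and> R s b \<and> (\<forall>m\<in>A. R m a \<and> R m b \<longrightarrow> R m s)"
proof -
  interpret L: Lattice.lattice "\<lparr>carrier = A, eq = (=), le = R\<rparr>" by (rule assms(1))
  show ?thesis using L.inf_of_two_exists[of a b] assms(2,3)
    by (auto simp: greatest_def Lower_def)
qed

locale weak_order_shift =
  fixes P :: "'a set" and leq :: "'a \<Rightarrow> 'a \<Rightarrow> bool" (infix "\<le>\<^sub>w" 50) and \<phi> :: "'a \<Rightarrow> 'a"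
  assumes weak_order: "weakly_ordered_set P leq"
    and automorphism: "order_automorphism P leq \<phi>"
    and increasing: "x \<in> P \<Longrightarrow> x \<le>\<^sub>w \<phi> x" "x \<in> P \<Longrightarrow> x \<noteq> \<phi> x"
begin

section \<open>The restricted relation and its associativity\<close>

abbreviation lep :: "'a \<Rightarrow> 'a \<Rightarrow> bool" (infix "\<sqsubseteq>" 50) where
  "lep \<equiv> le_phi P leq \<phi>"

lemma leq_refl: "a \<in> P \<Longrightarrow> a \<le>\<^sub>w a"
  using weak_order by (simp add: weakly_ordered_set_def)

lemma leq_antisym: "a \<in> P \<Longrightarrow> b \<in> P \<Longrightarrow> a \<le>\<^sub>w b \<Longrightarrow> b \<le>\<^sub>w a \<Longrightarrow> a = b"
  using weak_order by (simp add: weakly_ordered_set_def)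

lemma leq_assoc:
  assumes "a \<in> P" "b \<in> P" "c \<in> P" "d \<in> P" "a \<le>\<^sub>w b" "b \<le>\<^sub>w c" "c \<le>\<^sub>w d"
  shows "b \<le>\<^sub>w d \<and> a \<le>\<^sub>w d \<longleftrightarrow> a \<le>\<^sub>w c \<and> a \<le>\<^sub>w d"
proof -
  have "transitive_triple leq b c d \<and> transitive_triple leq a b d \<longleftrightarrow>
      transitive_triple leq a b c \<and> transitive_triple leq a c d"
    using weak_order[unfolded weakly_ordered_set_def, THEN conjunct2, THEN conjunct2] assms by blast
  then show ?thesis using assms(5-7) by (simp add: transitive_triple_def)
qed

lemma phi_P: "a \<in> P \<Longrightarrow> \<phi> a \<in> P"
  using automorphism by (auto simp: order_automorphism_def bij_betw_def)

lemma phi_leq_iff: "a \<in> P \<Longrightarrow> b \<in> P \<Longrightarrow> \<phi> a \<le>\<^sub>w \<phi> b \<longleftrightarrow> a \<le>\<^sub>w b"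
  using automorphism by (simp add: order_automorphism_def)

lemma phi_surj: "a \<in> P \<Longrightarrow> \<exists>b\<in>P. a = \<phi> b"
  using automorphism by (auto simp: order_automorphism_def bij_betw_def)

lemma lep_leq: "a \<sqsubseteq> b \<Longrightarrow> a \<in> P \<and> b \<in> P \<and> a \<le>\<^sub>w b"
  by (auto simp: le_phi_def interval_def)

lemma lepI:
  "x \<in> P \<Longrightarrow> a \<in> interval P leq x (\<phi> x) \<Longrightarrow> b \<in> interval P leq x (\<phi> x) \<Longrightarrow> a \<le>\<^sub>w b \<Longrightarrow> a \<sqsubseteq> b"
  unfolding le_phi_def by blast

text \<open>The witnessing interval can always be taken to start at \<open>a\<close>: applying
  \<open>\<phi>\<close> to \<open>x \<le>\<^sub>w a\<close> and using associativity along
  \<open>a, b, \<phi> x, \<phi> a\<close> moves the upper bound from \<open>\<phi> x\<close> to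
  \<open>\<phi> a\<close>.\<close>

lemma le_phi_iff: "a \<sqsubseteq> b \<longleftrightarrow> a \<in> P \<and> b \<in> P \<and> a \<le>\<^sub>w b \<and> b \<le>\<^sub>w \<phi> a"
proof
  assume ab: "a \<sqsubseteq> b"
  then obtain x where x: "x \<in> P" "x \<le>\<^sub>w a" "a \<le>\<^sub>w \<phi> x" "x \<le>\<^sub>w b" "b \<le>\<^sub>w \<phi> x"
    by (auto simp: le_phi_def interval_def)
  have a: "a \<in> P" "b \<in> P" "a \<le>\<^sub>w b" using lep_leq[OF ab] by auto
  have "\<phi> x \<le>\<^sub>w \<phi> a" using phi_leq_iff x a by simp
  then have "b \<le>\<^sub>w \<phi> a"
    using leq_assoc[of a b "\<phi> x" "\<phi> a"] a x phi_P increasing by blast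
  then show "a \<in> P \<and> b \<in> P \<and> a \<le>\<^sub>w b \<and> b \<le>\<^sub>w \<phi> a" using a by blast
next
  assume "a \<in> P \<and> b \<in> P \<and> a \<le>\<^sub>w b \<and> b \<le>\<^sub>w \<phi> a"
  then show "a \<sqsubseteq> b"
    using lepI[of a a b] leq_refl increasing by (simp add: interval_def)
qed

lemma interval_eq: "x \<in> P \<Longrightarrow> interval P leq x (\<phi> x) = {z. x \<sqsubseteq> z}"
  by (auto simp: interval_def le_phi_iff)

text \<open>Above a common lower bound the weak order condition becomes transitivity.\<close>

lemma leq_trans_above:
  assumes "x \<in> P" "a \<in> P" "b \<in> P" "c \<in> P" "x \<le>\<^sub>w a" "x \<le>\<^sub>w b" "x \<le>\<^sub>w c" "a \<le>\<^sub>w b" "b \<le>\<^sub>w c"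
  shows "a \<le>\<^sub>w c"
  using leq_assoc[of x a b c] assms by blast

lemma lep_above:
  assumes "x \<sqsubseteq> a" "x \<sqsubseteq> b" "a \<le>\<^sub>w b"
  shows "a \<sqsubseteq> b"
  using lepI[of x a b] assms interval_eq lep_leq[OF assms(1)] by simp

text \<open>By surjectivity \<open>x = \<phi> y\<close>, so both elements lie in the interval from
  \<open>y\<close> to \<open>\<phi> y\<close>.\<close>

lemma lep_below:
  assumes "a \<sqsubseteq> x" "b \<sqsubseteq> x" "a \<le>\<^sub>w b"
  shows "a \<sqsubseteq> b"
proof -
  have P: "a \<in> P" "b \<in> P" "x \<in> P" using assms lep_leq by blast+
  obtain y where y: "y \<in> P" "x = \<phi> y" using phi_surj P by blast
  then have "a \<in> interval P leq y (\<phi> y)" "b \<in> interval P leq y (\<phi> y)"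
    using assms(1,2) P phi_leq_iff by (auto simp: le_phi_iff interval_def)
  then show ?thesis using lepI y(1) assms(3) by blast
qed

text \<open>\<open>leq_assoc\<close> gives the equivalence for \<open>leq\<close>. The bounds
  \<open>a\<close> below and \<open>d\<close> above then upgrade each side to \<sqsubseteq>.\<close>

lemma lep_assoc:
  assumes "a \<sqsubseteq> b" "b \<sqsubseteq> c" "c \<sqsubseteq> d" "a \<sqsubseteq> d"
  shows "a \<sqsubseteq> c \<longleftrightarrow> b \<sqsubseteq> d"
proof -
  have P: "a \<in> P" "b \<in> P" "c \<in> P" "d \<in> P" using assms lep_leq by blast+
  have "b \<le>\<^sub>w d \<longleftrightarrow> a \<le>\<^sub>w c" using leq_assoc[OF P] assms lep_leq by blast
  then show ?thesis
    using lep_above[OF assms(1,4)] lep_below[OF assms(4,3)] lep_leq by blast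
qed

section \<open>Simplices of the complex\<close>

text \<open>The order is transitive inside the interval, so the relation between consecutive
  elements extends to all pairs. Faces and comparability can then be read off the list.\<close>

lemma simplex_sorted:
  assumes "\<sigma> \<in> X_phi P leq \<phi>"
  obtains x cs where "x \<in> P" "\<sigma> = set cs" "\<forall>a\<in>set cs. x \<sqsubseteq> a"
    "sorted_wrt (\<lambda>a b. a \<le>\<^sub>w b \<and> a \<noteq> b) cs"
proof -
  obtain cs x where cs: "\<sigma> = set cs" "weak_chain P leq cs" "x \<in> P" "set cs \<subseteq> interval P leq x (\<phi> x)"
    using assms by (auto simp: X_phi_def)
  have x: "x \<sqsubseteq> a" if "a \<in> set cs" for a using cs that interval_eq by auto
  have "sorted_wrt (\<lambda>a b. a \<le>\<^sub>w b \<and> a \<noteq> b) cs"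
  proof (rule successively_iff_sorted_wrt_strong[THEN iffD1])
    fix a b c assume "a \<in> set cs" "b \<in> set cs" "c \<in> set cs"
      and ab: "a \<le>\<^sub>w b \<and> a \<noteq> b" "b \<le>\<^sub>w c \<and> b \<noteq> c"
    then have "x \<sqsubseteq> a" "x \<sqsubseteq> b" "x \<sqsubseteq> c" using x by auto
    note l = this[THEN lep_leq]
    have "a \<le>\<^sub>w c" using leq_trans_above[of x a b c] l ab by blast
    moreover have "a \<noteq> c" using leq_antisym[of a b] l ab by blast
    ultimately show "a \<le>\<^sub>w c \<and> a \<noteq> c" ..
  qed (use cs(2) in \<open>simp add: weak_chain_def\<close>)
  then show ?thesis using that cs(1,3) x by blast
qed

lemma X_phiI:
  assumes "x \<in> P" "cs \<noteq> []" "\<And>a. a \<in> set cs \<Longrightarrow> x \<sqsubseteq> a" "successively (\<lambda>a b. a \<le>\<^sub>w b \<and> a \<noteq> b) cs"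
  shows "set cs \<in> X_phi P leq \<phi>"
proof -
  have "set cs \<subseteq> interval P leq x (\<phi> x)" using assms(1,3) interval_eq by auto
  moreover have "weak_chain P leq cs"
    using assms lep_leq unfolding weak_chain_def by blast
  ultimately show ?thesis using assms(1) unfolding X_phi_def by blast
qed

sublocale complex: face_closed "X_phi P leq \<phi>"
proof
  fix \<sigma> \<tau> assume \<sigma>: "\<sigma> \<in> X_phi P leq \<phi>" and \<tau>: "\<tau> \<subseteq> \<sigma>" "\<tau> \<noteq> {}"
  obtain x cs where cs: "x \<in> P" "\<sigma> = set cs" "\<forall>a\<in>set cs. x \<sqsubseteq> a"
      "sorted_wrt (\<lambda>a b. a \<le>\<^sub>w b \<and> a \<noteq> b) cs"
    using \<sigma> by (rule simplex_sorted)
  let ?cs = "filter (\<lambda>a. a \<in> \<tau>) cs"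
  have set: "set ?cs = \<tau>" using \<tau>(1) cs(2) by auto
  have "set ?cs \<in> X_phi P leq \<phi>"
  proof (rule X_phiI[OF cs(1)])
    show "?cs \<noteq> []" using set \<tau>(2) by (metis set_empty)
    show "successively (\<lambda>a b. a \<le>\<^sub>w b \<and> a \<noteq> b) ?cs"
      by (rule successively_if_sorted_wrt[OF sorted_wrt_filter[OF cs(4)]])
    show "x \<sqsubseteq> a" if "a \<in> set ?cs" for a using cs(3) that by simp
  qed
  then show "\<tau> \<in> X_phi P leq \<phi>" using set by simp
qed

lemma simplex_lep_comparable:
  assumes "\<sigma> \<in> X_phi P leq \<phi>"
  shows "\<exists>x. \<forall>a\<in>\<sigma>. x \<sqsubseteq> a \<and> (\<forall>b\<in>\<sigma>. a \<sqsubseteq> b \<or> b \<sqsubseteq> a)"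
proof -
  obtain x cs where cs: "\<sigma> = set cs" "\<forall>a\<in>set cs. x \<sqsubseteq> a"
      "sorted_wrt (\<lambda>a b. a \<le>\<^sub>w b \<and> a \<noteq> b) cs"
    using assms by (rule simplex_sorted)
  have "a \<sqsubseteq> b \<or> b \<sqsubseteq> a" if ab: "a \<in> set cs" "b \<in> set cs" for a b
  proof -
    obtain i j where ij: "i < length cs" "a = cs ! i" "j < length cs" "b = cs ! j"
      using ab by (metis in_set_conv_nth)
    consider "i < j" | "j < i" | "i = j" by linarith
    then have "a \<le>\<^sub>w b \<or> b \<le>\<^sub>w a"
    proof cases
      case 3
      then show ?thesis using ij leq_refl lep_leq[of x a] cs(2) ab(1) by simp
    qed (use ij sorted_wrt_nth_less[OF cs(3)] in auto)
    then show ?thesis using lep_above cs(2) ab by blast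
  qed
  then show ?thesis using cs(1,2) by blast
qed

lemma edge_in_X_phi:
  assumes "a \<sqsubseteq> b"
  shows "{a, b} \<in> X_phi P leq \<phi>"
proof -
  have a: "a \<in> P" "a \<sqsubseteq> a" "a \<le>\<^sub>w b"
    using lep_leq[OF assms] leq_refl increasing by (auto simp: le_phi_iff)
  have "set (if a = b then [a] else [a, b]) \<in> X_phi P leq \<phi>"
    by (rule X_phiI[OF a(1)]) (use a assms in \<open>auto split: if_splits\<close>)
  then show ?thesis by (simp split: if_splits)
qed

end

theorem theorem7:
  fixes P :: "'a set" and leq :: "'a \<Rightarrow> 'a \<Rightarrow> bool"
  assumes "weakly_ordered_set P leq"
    and "homogeneous P leq"
    and "\<exists>\<phi>. order_automorphism P leq \<phi> \<and>
           generates_relation P leq \<phi> \<and>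
           (\<forall>x\<in>P. leq x (\<phi> x) \<and> x \<noteq> \<phi> x) \<and>
           simply_connected_space (realization (X_phi P leq \<phi>)) \<and>
           (\<forall>x\<in>P. lattice_on (interval P leq x (\<phi> x)) leq)"
  shows "generates_partial_order P leq \<and>
    (\<forall>x\<in>P. lattice_on {y \<in> P. le_t P leq x y} (le_t P leq) \<and>
            lattice_on {y \<in> P. le_t P leq y x} (le_t P leq))"
proof -
  obtain \<phi> where \<phi>: "order_automorphism P leq \<phi>" "generates_relation P leq \<phi>"
      "\<forall>x\<in>P. leq x (\<phi> x) \<and> x \<noteq> \<phi> x"
      "simply_connected_space (realization (X_phi P leq \<phi>))"
      "\<forall>x\<in>P. lattice_on (interval P leq x (\<phi> x)) leq"
    using assms(3) by (elim exE conjE) (rule that)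
  interpret W: weak_order_shift P leq \<phi>
    using assms(1) \<phi>(1,3) by unfold_locales auto
  let ?R = "le_phi P leq \<phi>" and ?K = "X_phi P leq \<phi>"
  obtain l :: "'a \<Rightarrow> 'a \<Rightarrow> nat" where
    l: "\<forall>a\<in>P. \<forall>b\<in>P. \<forall>c\<in>P. transitive_triple leq a b c \<longrightarrow> l a c = l a b + l b c"
      "\<forall>a\<in>P. \<forall>b\<in>P. leq a b \<longrightarrow> (l a b = 0 \<longleftrightarrow> a = b)"
    using assms(2) unfolding homogeneous_def by (elim exE conjE) (rule that)
  interpret G: garside_germ P ?R \<phi> l ?K
  proof
    fix a b assume "?R a b"
    then show "a \<in> P \<and> b \<in> P" using W.lep_leq by blast
  next
    fix a assume "a \<in> P"
    then show "?R a a" "?R a (\<phi> a)" "\<phi> a \<noteq> a"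
      using W.leq_refl W.increasing(1) W.increasing(2)[of a] W.phi_P by (auto simp: W.le_phi_iff)
  next
    fix a b assume "?R a b" "?R b a"
    then show "a = b" using W.leq_antisym W.lep_leq by blast
  next
    fix a b c d assume "?R a b" "?R b c" "?R c d" "?R a d"
    then show "?R a c \<longleftrightarrow> ?R b d" by (rule W.lep_assoc)
  next
    show "bij_betw \<phi> P P" using \<phi>(1) by (simp add: order_automorphism_def)
  next
    fix a b assume "a \<in> P" "b \<in> P"
    then show "?R (\<phi> a) (\<phi> b) \<longleftrightarrow> ?R a b"
      using W.phi_leq_iff W.phi_P by (simp add: W.le_phi_iff)
  next
    fix a b assume "?R a b"
    then show "?R b (\<phi> a)" using W.phi_leq_iff W.phi_P by (simp add: W.le_phi_iff)
  next
    fix a b c assume ab: "?R a b" and ac: "?R a c"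
    have a: "a \<in> P" using W.lep_leq[OF ab] by blast
    \<comment> \<open>The interval is a lattice for \<open>leq\<close>; \<open>W.lep_above\<close>
      upgrades \<open>leq\<close> to \<open>?R\<close> between elements of the interval.\<close>
    have "lattice_on {z. ?R a z} leq" using \<phi>(5)[rule_format, OF a] unfolding W.interval_eq[OF a] .
    then obtain s where s: "?R a s" "leq b s" "leq c s"
        "\<And>m. ?R a m \<Longrightarrow> leq b m \<Longrightarrow> leq c m \<Longrightarrow> leq s m"
      using lattice_on_ex_lub[of "{z. ?R a z}" leq b c] ab ac by auto
    have "?R s m" if m: "?R a m" "?R b m" "?R c m" for m
      using W.lep_above[OF s(1) m(1)] s(4)[OF m(1)] m(2,3) W.lep_leq by blast
    then show "\<exists>j. ?R a j \<and> ?R b j \<and> ?R c j \<and> (\<forall>m. ?R a m \<and> ?R b m \<and> ?R c m \<longrightarrow> ?R j m)"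
      using s(1) W.lep_above[OF ab s(1,2)] W.lep_above[OF ac s(1,3)] by blast
  next
    fix a b c assume "?R a b" "?R b c" "?R a c"
    note this[THEN W.lep_leq]
    then show "l a c = l a b + l b c" using l(1) by (simp add: transitive_triple_def)
  next
    fix a b assume ab: "?R a b"
    show "l a b = 0 \<longleftrightarrow> a = b" using l(2) W.lep_leq[OF ab] by simp
    show "{a, b} \<in> ?K" using ab by (rule W.edge_in_X_phi)
  next
    fix \<sigma> assume "\<sigma> \<in> ?K"
    then show "\<exists>x. \<forall>a\<in>\<sigma>. ?R x a \<and> (\<forall>b\<in>\<sigma>. ?R a b \<or> ?R b a)" by (rule W.simplex_lep_comparable)
  next
    fix w assume "edge_path ?K w" "hd w = last w"
    then show "edge_homotopic ?K w [hd w]"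
      by (rule W.complex.simply_connected_imp_edge_homotopic[OF \<phi>(4)])
  qed
  \<comment> \<open>The reversed structure, whose joins are meets in the given intervals; it yields
    the lattices below \<open>x\<close>.\<close>
  interpret D: garside_germ P "\<lambda>a b. ?R b a" "inv_into P \<phi>" "\<lambda>a b. l b a" ?K
  proof (rule G.garside_germ_converse)
    fix a b c assume ba: "?R b a" and ca: "?R c a"
    obtain x where x: "x \<in> P" "a = \<phi> x" using W.phi_surj W.lep_leq[OF ba] by blast
    \<comment> \<open>The elements below \<open>a = \<phi> x\<close> form the interval with top
      \<open>a\<close>, which is a lattice by hypothesis.\<close>
    have down: "{z. ?R z a} = interval P leq x (\<phi> x)"
      using x W.phi_leq_iff W.phi_P by (auto simp: W.le_phi_iff interval_def)
    have "lattice_on {z. ?R z a} leq" using \<phi>(5)[rule_format, OF x(1)] unfolding down .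
    then obtain s where s: "?R s a" "leq s b" "leq s c"
        "\<And>m. ?R m a \<Longrightarrow> leq m b \<Longrightarrow> leq m c \<Longrightarrow> leq m s"
      using lattice_on_ex_glb[of "{z. ?R z a}" leq b c] ba ca by auto
    have "?R m s" if m: "?R m a" "?R m b" "?R m c" for m
      using W.lep_below[OF m(1) s(1)] s(4)[OF m(1)] m(2,3) W.lep_leq by blast
    then show "\<exists>j. ?R j a \<and> ?R j b \<and> ?R j c \<and> (\<forall>m. ?R m a \<and> ?R m b \<and> ?R m c \<longrightarrow> ?R m j)"
      using s(1) W.lep_below[OF s(1) ba s(2)] W.lep_below[OF s(1) ca s(3)] by blast
  qed
  \<comment> \<open>As \<open>\<phi>\<close> generates \<open>leq\<close>, every step of a weak
    chain refines to steps of \<open>?R\<close>; hence both relations generate the same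
    order.\<close>
  have chain_tle: "le_t P ?R (hd cs) (last cs)" if "weak_chain P leq cs" for cs
    using that
  proof (induction cs rule: induct_list012)
    case (3 a b cs)
    have ab: "a \<in> P" "b \<in> P" "leq a b" "weak_chain P leq (b # cs)"
      using "3.prems" by (auto simp: weak_chain_def)
    have "le_t P ?R a b"
      unfolding le_t_def
      by (rule \<phi>(2)[unfolded generates_relation_def, rule_format, OF ab(1-3)])
    also have "le_t P ?R b (last (b # cs))" using "3.IH"(2)[OF ab(4)] by simp
    finally show ?case by simp
  qed (auto simp: weak_chain_def intro: G.tle_refl)
  have tle_eq: "le_t P leq a b \<longleftrightarrow> le_t P ?R a b" for a b
  proof
    assume "le_t P leq a b"
    then show "le_t P ?R a b" using chain_tle unfolding le_t_def[of P leq] by blast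
  next
    assume "le_t P ?R a b"
    then obtain cs where cs: "weak_chain P ?R cs" "hd cs = a" "last cs = b"
      by (rule G.tleE)
    have "weak_chain P leq cs"
      using cs(1) successively_mono[of "\<lambda>a b. ?R a b \<and> a \<noteq> b" cs "\<lambda>a b. leq a b \<and> a \<noteq> b"] W.lep_leq
      by (simp add: weak_chain_def)
    then show "le_t P leq a b" using cs(2,3) unfolding le_t_def by blast
  qed
  have "generates_partial_order P leq"
    unfolding generates_partial_order_def
  proof
    assume "\<exists>cs. weak_chain P leq cs \<and> 2 \<le> length cs \<and> hd cs = last cs"
    then obtain cs where cs: "weak_chain P leq cs" "2 \<le> length cs" "hd cs = last cs" by blast
    then obtain a b p where p: "cs = a # b # p"
      by (cases cs; cases "tl cs") auto
    \<comment> \<open>A closed weak chain splits into its first step and the rest, which give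
      opposite inequalities between distinct elements.\<close>
    then have ab: "weak_chain P leq [a, b]" "weak_chain P leq (b # p)" "a \<noteq> b"
      using cs(1) by (auto simp: weak_chain_def)
    have "le_t P ?R a b" "le_t P ?R b a"
      using chain_tle[OF ab(1)] chain_tle[OF ab(2)] cs(3) p by auto
    then show False using G.tle_antisym ab(3) by blast
  qed
  moreover have "lattice_on {y \<in> P. le_t P leq x y} (le_t P leq)" if x: "x \<in> P" for x
    unfolding tle_eq
  proof (rule lattice_onI)
    fix a b assume "a \<in> {y \<in> P. le_t P ?R x y}" "b \<in> {y \<in> P. le_t P ?R x y}"
    then have ab: "le_t P ?R x a" "le_t P ?R x b" by auto
    show "\<exists>s\<in>{y \<in> P. le_t P ?R x y}. le_t P ?R a s \<and> le_t P ?R b s \<and>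
        (\<forall>m\<in>{y \<in> P. le_t P ?R x y}. le_t P ?R a m \<and> le_t P ?R b m \<longrightarrow> le_t P ?R s m)"
      using G.tle_ex_lub[OF ab] G.tle_carrier by blast
    show "\<exists>s\<in>{y \<in> P. le_t P ?R x y}. le_t P ?R s a \<and> le_t P ?R s b \<and>
        (\<forall>m\<in>{y \<in> P. le_t P ?R x y}. le_t P ?R m a \<and> le_t P ?R m b \<longrightarrow> le_t P ?R m s)"
      using G.tle_ex_glb[OF ab] G.tle_carrier by blast
  qed (use G.tle_refl G.tle_antisym in auto, use G.tle_trans in blast)
  moreover have "lattice_on {y \<in> P. le_t P leq y x} (le_t P leq)" if x: "x \<in> P" for x
    unfolding tle_eq
  proof (rule lattice_onI)
    fix a b assume "a \<in> {y \<in> P. le_t P ?R y x}" "b \<in> {y \<in> P. le_t P ?R y x}"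
    then have ab: "le_t P (\<lambda>a b. ?R b a) x a" "le_t P (\<lambda>a b. ?R b a) x b"
      by (auto simp: le_t_converse[of P ?R])
    \<comment> \<open>Translating back exchanges the roles: joins of the reversed order are meets of
      the original one, and conversely.\<close>
    note lub = D.tle_ex_lub[OF ab, unfolded le_t_converse[of P ?R]]
      and glb = D.tle_ex_glb[OF ab, unfolded le_t_converse[of P ?R]]
    show "\<exists>s\<in>{y \<in> P. le_t P ?R y x}. le_t P ?R a s \<and> le_t P ?R b s \<and>
        (\<forall>m\<in>{y \<in> P. le_t P ?R y x}. le_t P ?R a m \<and> le_t P ?R b m \<longrightarrow> le_t P ?R s m)"
      using glb G.tle_carrier by blast
    show "\<exists>s\<in>{y \<in> P. le_t P ?R y x}. le_t P ?R s a \<and> le_t P ?R s b \<and>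
        (\<forall>m\<in>{y \<in> P. le_t P ?R y x}. le_t P ?R m a \<and> le_t P ?R m b \<longrightarrow> le_t P ?R m s)"
      using lub G.tle_carrier by blast
  qed (use G.tle_refl G.tle_antisym in auto, use G.tle_trans in blast)
  ultimately show ?thesis by blast
qed

end
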